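(* Let $M$ be a smooth manifold with tangent bundle $\pi:TM\to M$ and mirror map $B$. Let $$Z=\{\alpha\in\Omega^1(TM):\ d\alpha=0\ \text{and there exists } \mu\in\Omega^1(M)\text{ with }\alpha\circ B=\pi^*\mu\}$$ and $$E=\{df_{\nu,c}:\ \nu\in\Omega^1(M),\ c\in C^\infty(M)\},$$ where $f_{\nu,c}\in C^\infty(TM)$ is the function $f_{\nu,c}(u)=\nu_{\pi(u)}(u)+c(\pi(u))$, $u\in TM$. Then $E$ is a linear subspace of $Z$ and there is an isomorphism of real vector spaces $$Z/E\;\simeq\;H^1(M;\mathbb{R}).$$
   Context: $M$ is a smooth (Hausdorff, second countable) manifold of dimension $m$. A chart $(x^i)$ on $M$ induces the chart $(x^i,v^j)$ on $TM$, with $v^j$ the components of a tangent vector in the basis $\partial/\partial x^j$. The mirror map $B$ is the globally defined endomorphism of $T(TM)$ given in any induced chart by $B=\sum_{j=1}^m dx^j\otimes\frac{\partial}{\partial v^j}$, i.e. $B(\partial/\partial x^j)=\partial/\partial v^j$, $B(\partial/\partial v^j)=0$. For a $1$-form $\alpha$ on $TM$, $(\alpha\circ B)(Y)=\alpha(BY)$. A $1$-form $\alpha$ on $TM$ with $\alpha\circ B=\pi^*\mu$ for a $1$-form $\mu$ on $M$ is called a form of type $\alpha_\mu$; locally, if $\mu=a_i(x)dx^i$, it is $\alpha_\mu=h_i\,dx^i+a_i\,dv^i$ with $h_i$ functions of $(x,v)$. In a chart with $\nu=a_i\,dx^i$, the function $f_{\nu,c}$ is $a_i(x)v^i+c(x)$.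 $H^1(M;\mathbb{R})$ is the first de Rham cohomology of $M$. *)

theory Defs
  imports
    "HOL-Analysis.Analysis"
    "HOL-Library.Function_Algebras"
    "HOL-Library.Set_Algebras"
begin

section \<open>Linear algebra\<close>

text \<open>
  The model space of an $m$-dimensional manifold is a finite-dimensional real inner product
  space. The class \<^class>\<open>euclidean_space\<close> is not used because it excludes dimension $0$.
\<close>

class finite_dim_inner = real_inner +
  assumes finite_spanning_set: "\<exists>B. finite B \<and> (\<forall>x. \<exists>c. x = (\<Sum>b\<in>B. c b *\<^sub>R b))"

lemma finite_dim_inner_iff:
  "(\<exists>B::'a::real_vector set. finite B \<and> (\<forall>x. \<exists>c. x = (\<Sum>b\<in>B. c b *\<^sub>R b)))
    \<longleftrightarrow> (\<exists>B::'a set. finite B \<and> span B = UNIV)"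
proof -
  have "(\<forall>x. \<exists>c. x = (\<Sum>b\<in>B. c b *\<^sub>R b)) \<longleftrightarrow> span B = UNIV" if "finite B" for B :: "'a set"
    unfolding span_finite[OF that] by (auto simp: image_def set_eq_iff)
  then show ?thesis by blast
qed

instance euclidean_space \<subseteq> finite_dim_inner
proof
  show "\<exists>B::'a set. finite B \<and> (\<forall>x. \<exists>c. x = (\<Sum>b\<in>B. c b *\<^sub>R b))"
    unfolding finite_dim_inner_iff using finite_Basis span_Basis by blast
qed

instance prod :: (finite_dim_inner, finite_dim_inner) finite_dim_inner
proof
  obtain B :: "'a set" where B: "finite B" "span B = UNIV"
    using finite_spanning_set unfolding finite_dim_inner_iff by blast
  obtain C :: "'b set" where C: "finite C" "span C = UNIV"
    using finite_spanning_set unfolding finite_dim_inner_iff by blast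
  define D where "D = (\<lambda>x. (x, 0::'b)) ` B \<union> (\<lambda>y. (0::'a, y)) ` C"
  have "(x, y) \<in> span D" for x :: 'a and y :: 'b
  proof -
    have l1: "linear (\<lambda>x. (x::'a, 0::'b))" and l2: "linear (\<lambda>y. (0::'a, y::'b))"
      by (auto intro!: linearI)
    have "(x, 0) \<in> span ((\<lambda>x. (x, 0::'b)) ` B)"
      using linear_span_image[OF l1, of B] B(2) by auto
    moreover have "(0, y) \<in> span ((\<lambda>y. (0::'a, y)) ` C)"
      using linear_span_image[OF l2, of C] C(2) by auto
    ultimately have "(x, 0) \<in> span D" "(0, y) \<in> span D"
      unfolding D_def by (meson span_mono subsetD Un_upper1 Un_upper2)+
    then have "(x, 0) + (0, y) \<in> span D" by (rule span_add)
    then show ?thesis by simp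
  qed
  moreover have "finite D" using B(1) C(1) by (simp add: D_def)
  ultimately have "\<exists>B::('a \<times> 'b) set. finite B \<and> span B = UNIV" by auto
  then show "\<exists>B::('a \<times> 'b) set. finite B \<and> (\<forall>x. \<exists>c. x = (\<Sum>b\<in>B. c b *\<^sub>R b))"
    unfolding finite_dim_inner_iff .
qed

text \<open>Functions into a real vector space, with pointwise operations.\<close>

instantiation "fun" :: (type, real_vector) real_vector
begin

definition scaleR_fun :: "real \<Rightarrow> ('a \<Rightarrow> 'b) \<Rightarrow> 'a \<Rightarrow> 'b"
  where "scaleR_fun r f = (\<lambda>x. r *\<^sub>R f x)"

instance
  by standard (auto simp: scaleR_fun_def fun_eq_iff scaleR_add_right scaleR_add_left)

end

record 'v vs_structure =
  vs_carrier :: "'v set"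
  vs_add :: "'v \<Rightarrow> 'v \<Rightarrow> 'v"
  vs_scale :: "real \<Rightarrow> 'v \<Rightarrow> 'v"

text \<open>
  The quotient of a vector space \<open>V\<close> by a subspace \<open>W\<close>: the elements are the cosets \<open>x +o W\<close>,
  the sum of two cosets is their element-wise sum, and \<open>r\<close> times the coset of \<open>x\<close> is the
  coset of \<open>r *\<^sub>R x\<close>. The summand from \<open>W\<close> in the last component makes this right for \<open>r = 0\<close>.
\<close>

definition quotient_vs :: "'v::real_vector set \<Rightarrow> 'v set \<Rightarrow> 'v set vs_structure" where
  "quotient_vs V W =
     \<lparr>vs_carrier = (\<lambda>x. x +o W) ` V,
      vs_add = (\<lambda>C D. C + D),
      vs_scale = (\<lambda>r C. (\<lambda>x. r *\<^sub>R x) ` C + W)\<rparr>"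

definition vs_isomorphic :: "'v vs_structure \<Rightarrow> 'w vs_structure \<Rightarrow> bool" where
  "vs_isomorphic V W \<longleftrightarrow>
     (\<exists>\<Phi>. bij_betw \<Phi> (vs_carrier V) (vs_carrier W) \<and>
       (\<forall>x\<in>vs_carrier V. \<forall>y\<in>vs_carrier V. \<Phi> (vs_add V x y) = vs_add W (\<Phi> x) (\<Phi> y)) \<and>
       (\<forall>r. \<forall>x\<in>vs_carrier V. \<Phi> (vs_scale V r x) = vs_scale W r (\<Phi> x)))"


section \<open>Smooth manifolds\<close>

text \<open>
  \<open>Ck_on k f S\<close>: \<open>f\<close> is of class $C^k$ on the open set \<open>S\<close>. The recursion uses directional
  derivatives, which is equivalent to the usual notion as the domain is finite-dimensional.
\<close>

primrec Ck_on :: "nat \<Rightarrow> ('a::finite_dim_inner \<Rightarrow> 'b::real_normed_vector) \<Rightarrow> 'a set \<Rightarrow> bool" where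
  "Ck_on 0 f S \<longleftrightarrow> continuous_on S f"
| "Ck_on (Suc k) f S \<longleftrightarrow>
     (\<forall>x\<in>S. f differentiable at x) \<and> (\<forall>v. Ck_on k (\<lambda>x. frechet_derivative f (at x) v) S)"

definition smooth_on :: "('a::finite_dim_inner \<Rightarrow> 'b::real_normed_vector) \<Rightarrow> 'a set \<Rightarrow> bool" where
  "smooth_on f S \<longleftrightarrow> (\<forall>k. Ck_on k f S)"

text \<open>A chart is its domain together with a map of which only the values on the domain matter.\<close>

type_synonym ('a, 'e) chart = "'a set \<times> ('a \<Rightarrow> 'e)"

abbreviation chart_dom :: "('a, 'e) chart \<Rightarrow> 'a set" where
  "chart_dom \<equiv> fst"

abbreviation chart_map :: "('a, 'e) chart \<Rightarrow> 'a \<Rightarrow> 'e" where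
  "chart_map \<equiv> snd"

definition chart_image :: "('a, 'e) chart \<Rightarrow> 'e set" where
  "chart_image \<phi> = chart_map \<phi> ` chart_dom \<phi>"

definition chart_inv :: "('a, 'e) chart \<Rightarrow> 'e \<Rightarrow> 'a" where
  "chart_inv \<phi> = inv_into (chart_dom \<phi>) (chart_map \<phi>)"

definition transition :: "('a, 'e) chart \<Rightarrow> ('a, 'e) chart \<Rightarrow> 'e \<Rightarrow> 'e" where
  "transition \<phi> \<psi> = chart_map \<psi> \<circ> chart_inv \<phi>"

text \<open>
  \<open>X\<close> is the underlying space and \<open>A\<close> a smooth atlas, not necessarily the maximal one: smoothness
  of functions and forms does not depend on the choice within the smooth structure. The dimension
  \<open>m\<close> may be \<open>0\<close>, and \<open>X\<close> need not be connected. The existential clause is second countability.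
\<close>

definition smooth_manifold ::
    "nat \<Rightarrow> 'a topology \<Rightarrow> ('a, 'e::finite_dim_inner) chart set \<Rightarrow> bool" where
  "smooth_manifold m X A \<longleftrightarrow>
     dim (UNIV :: 'e set) = m \<and>
     Hausdorff_space X \<and>
     (\<exists>\<B>. countable \<B> \<and> (\<forall>V\<in>\<B>. openin X V) \<and>
        (\<forall>U x. openin X U \<and> x \<in> U \<longrightarrow> (\<exists>V\<in>\<B>. x \<in> V \<and> V \<subseteq> U))) \<and>
     topspace X = (\<Union>\<phi>\<in>A. chart_dom \<phi>) \<and>
     (\<forall>\<phi>\<in>A. openin X (chart_dom \<phi>) \<and> open (chart_image \<phi>) \<and>
        homeomorphic_map (subtopology X (chart_dom \<phi>)) (top_of_set (chart_image \<phi>))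
          (chart_map \<phi>)) \<and>
     (\<forall>\<phi>\<in>A. \<forall>\<psi>\<in>A.
        smooth_on (transition \<phi> \<psi>) (chart_map \<phi> ` (chart_dom \<phi> \<inter> chart_dom \<psi>)))"

definition points :: "('a, 'e) chart set \<Rightarrow> 'a set" where
  "points A = (\<Union>\<phi>\<in>A. chart_dom \<phi>)"

definition charts_at :: "('a, 'e) chart set \<Rightarrow> 'a \<Rightarrow> ('a, 'e) chart set" where
  "charts_at A p = {\<phi>\<in>A. p \<in> chart_dom \<phi>}"

text \<open>
  The choice of a chart around a point. All objects defined with its help below (differentials,
  tangent maps, exterior derivatives) are independent of it for smooth data.
\<close>

definition some_chart :: "('a, 'e) chart set \<Rightarrow> 'a \<Rightarrow> ('a, 'e) chart" where
  "some_chart A p = (SOME \<phi>. \<phi> \<in> charts_at A p)"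

definition smooth_functions :: "('a, 'e::finite_dim_inner) chart set \<Rightarrow> ('a \<Rightarrow> real) set" where
  "smooth_functions A = {f. \<forall>\<phi>\<in>A. smooth_on (f \<circ> chart_inv \<phi>) (chart_image \<phi>)}"


section \<open>Tangent vectors\<close>

text \<open>
  A tangent vector at \<open>p\<close> is the family of its components in the charts around \<open>p\<close>, which are
  related by the derivatives of the transition maps. It is set to \<open>0\<close> on all other charts.
\<close>

type_synonym ('a, 'e) tvec = "('a, 'e) chart \<Rightarrow> 'e"

definition tangent_space ::
    "('a, 'e::finite_dim_inner) chart set \<Rightarrow> 'a \<Rightarrow> ('a, 'e) tvec set" where
  "tangent_space A p =
     {v. (\<forall>\<phi>. \<phi> \<notin> charts_at A p \<longrightarrow> v \<phi> = 0) \<and>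
         (\<forall>\<phi>\<in>charts_at A p. \<forall>\<psi>\<in>charts_at A p.
            v \<psi> = frechet_derivative (transition \<phi> \<psi>) (at (chart_map \<phi> p)) (v \<phi>))}"

text \<open>
  The tangent vector at \<open>p\<close> with components \<open>a\<close> in the chart \<open>\<phi>\<close>, that is,
  $\sum_i a^i\,\partial/\partial x^i$ at \<open>p\<close>.
\<close>

definition tvec_of ::
    "('a, 'e::finite_dim_inner) chart set \<Rightarrow> ('a, 'e) chart \<Rightarrow> 'a \<Rightarrow> 'e \<Rightarrow> ('a, 'e) tvec" where
  "tvec_of A \<phi> p a =
     (\<lambda>\<psi>. if \<psi> \<in> charts_at A p
           then frechet_derivative (transition \<phi> \<psi>) (at (chart_map \<phi> p)) a else 0)"

text \<open>
  The tangent bundle is again given by an atlas: its points are the pairs \<open>(p, v)\<close> with \<open>v\<close>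
  tangent at \<open>p\<close>, and each chart $(x^i)$ of the manifold induces the chart $(x^i, v^j)$.
\<close>

definition induced_chart ::
    "('a, 'e::finite_dim_inner) chart set \<Rightarrow> ('a, 'e) chart \<Rightarrow>
     ('a \<times> ('a, 'e) tvec, 'e \<times> 'e) chart" where
  "induced_chart A \<phi> =
     (Sigma (chart_dom \<phi>) (tangent_space A), \<lambda>(p, v). (chart_map \<phi> p, v \<phi>))"

definition tangent_atlas ::
    "('a, 'e::finite_dim_inner) chart set \<Rightarrow> ('a \<times> ('a, 'e) tvec, 'e \<times> 'e) chart set" where
  "tangent_atlas A = induced_chart A ` A"

definition tangent_map ::
    "('a, 'e::finite_dim_inner) chart set \<Rightarrow> ('b, 'f::finite_dim_inner) chart set \<Rightarrow>
     ('a \<Rightarrow> 'b) \<Rightarrow> 'a \<Rightarrow> ('a, 'e) tvec \<Rightarrow> ('b, 'f) tvec" where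
  "tangent_map A A' F p v =
     (let \<phi> = some_chart A p in
       (\<lambda>\<psi>. if \<psi> \<in> charts_at A' (F p)
             then frechet_derivative (chart_map \<psi> \<circ> F \<circ> chart_inv \<phi>) (at (chart_map \<phi> p)) (v \<phi>)
             else 0))"


section \<open>Differential forms\<close>

text \<open>
  Since forms are total functions, they are extended by \<open>0\<close> to arguments that are not tangent
  vectors. This makes the forms a subspace of a function space, with equality as in mathematics.
\<close>

definition local_form ::
    "('a, 'e::finite_dim_inner) chart set \<Rightarrow> ('a \<Rightarrow> ('a, 'e) tvec \<Rightarrow> real) \<Rightarrow>
     ('a, 'e) chart \<Rightarrow> 'e \<Rightarrow> 'e \<Rightarrow> real" where
  "local_form A \<alpha> \<phi> x a = \<alpha> (chart_inv \<phi> x) (tvec_of A \<phi> (chart_inv \<phi> x) a)"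

definition one_forms ::
    "('a, 'e::finite_dim_inner) chart set \<Rightarrow> ('a \<Rightarrow> ('a, 'e) tvec \<Rightarrow> real) set" where
  "one_forms A =
     {\<alpha>. (\<forall>p v. \<not> (p \<in> points A \<and> v \<in> tangent_space A p) \<longrightarrow> \<alpha> p v = 0) \<and>
         (\<forall>p\<in>points A. \<forall>v\<in>tangent_space A p. \<forall>w\<in>tangent_space A p.
            \<alpha> p (v + w) = \<alpha> p v + \<alpha> p w) \<and>
         (\<forall>p\<in>points A. \<forall>v\<in>tangent_space A p. \<forall>r. \<alpha> p (r *\<^sub>R v) = r * \<alpha> p v) \<and>
         (\<forall>\<phi>\<in>A. \<forall>a. smooth_on (\<lambda>x. local_form A \<alpha> \<phi> x a) (chart_image \<phi>))}"

definition differential ::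
    "('a, 'e::finite_dim_inner) chart set \<Rightarrow> ('a \<Rightarrow> real) \<Rightarrow> 'a \<Rightarrow> ('a, 'e) tvec \<Rightarrow> real" where
  "differential A f p v =
     (if p \<in> points A \<and> v \<in> tangent_space A p
      then let \<phi> = some_chart A p
           in frechet_derivative (f \<circ> chart_inv \<phi>) (at (chart_map \<phi> p)) (v \<phi>)
      else 0)"

text \<open>
  The exterior derivative of $\alpha = \alpha_i\,dx^i$ is
  $d\alpha(v, w) = (\partial_i \alpha_j - \partial_j \alpha_i)\, v^i w^j$.
\<close>

definition ext_deriv ::
    "('a, 'e::finite_dim_inner) chart set \<Rightarrow> ('a \<Rightarrow> ('a, 'e) tvec \<Rightarrow> real) \<Rightarrow>
     'a \<Rightarrow> ('a, 'e) tvec \<Rightarrow> ('a, 'e) tvec \<Rightarrow> real" where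
  "ext_deriv A \<alpha> p v w =
     (if p \<in> points A \<and> v \<in> tangent_space A p \<and> w \<in> tangent_space A p
      then let \<phi> = some_chart A p; x = chart_map \<phi> p
           in frechet_derivative (\<lambda>y. local_form A \<alpha> \<phi> y (w \<phi>)) (at x) (v \<phi>) -
              frechet_derivative (\<lambda>y. local_form A \<alpha> \<phi> y (v \<phi>)) (at x) (w \<phi>)
      else 0)"

definition pullback ::
    "('a, 'e::finite_dim_inner) chart set \<Rightarrow> ('b, 'f::finite_dim_inner) chart set \<Rightarrow>
     ('a \<Rightarrow> 'b) \<Rightarrow> ('b \<Rightarrow> ('b, 'f) tvec \<Rightarrow> real) \<Rightarrow> 'a \<Rightarrow> ('a, 'e) tvec \<Rightarrow> real" where
  "pullback A A' F \<mu> p v =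
     (if p \<in> points A \<and> v \<in> tangent_space A p then \<mu> (F p) (tangent_map A A' F p v) else 0)"

definition deRham_H1 ::
    "('a, 'e::finite_dim_inner) chart set \<Rightarrow> ('a \<Rightarrow> ('a, 'e) tvec \<Rightarrow> real) set vs_structure" where
  "deRham_H1 A =
     quotient_vs {\<beta> \<in> one_forms A. ext_deriv A \<beta> = 0} (differential A ` smooth_functions A)"


section \<open>The mirror map\<close>

text \<open>
  At a point \<open>u\<close> of the tangent bundle, the component of a tangent vector in an induced chart
  is a pair $(\dot x, \dot v)$, and the mirror map sends it to $(0, \dot x)$.
\<close>

definition mirror ::
    "('a, 'e::finite_dim_inner) chart set \<Rightarrow> 'a \<times> ('a, 'e) tvec \<Rightarrow>
     ('a \<times> ('a, 'e) tvec, 'e \<times> 'e) tvec \<Rightarrow> ('a \<times> ('a, 'e) tvec, 'e \<times> 'e) tvec" where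
  "mirror A u Y =
     (\<lambda>\<Psi>. if \<Psi> \<in> charts_at (tangent_atlas A) u then (0, fst (Y \<Psi>)) else 0)"

definition comp_mirror ::
    "('a, 'e::finite_dim_inner) chart set \<Rightarrow>
     ('a \<times> ('a, 'e) tvec \<Rightarrow> ('a \<times> ('a, 'e) tvec, 'e \<times> 'e) tvec \<Rightarrow> real) \<Rightarrow>
     'a \<times> ('a, 'e) tvec \<Rightarrow> ('a \<times> ('a, 'e) tvec, 'e \<times> 'e) tvec \<Rightarrow> real" where
  "comp_mirror A \<alpha> u Y =
     (if u \<in> points (tangent_atlas A) \<and> Y \<in> tangent_space (tangent_atlas A) u
      then \<alpha> u (mirror A u Y) else 0)"

definition f_form ::
    "('a \<Rightarrow> ('a, 'e) tvec \<Rightarrow> real) \<Rightarrow> ('a \<Rightarrow> real) \<Rightarrow> 'a \<times> ('a, 'e) tvec \<Rightarrow> real" where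
  "f_form \<nu> c u = \<nu> (fst u) (snd u) + c (fst u)"

definition Z_forms ::
    "('a, 'e::finite_dim_inner) chart set \<Rightarrow>
     ('a \<times> ('a, 'e) tvec \<Rightarrow> ('a \<times> ('a, 'e) tvec, 'e \<times> 'e) tvec \<Rightarrow> real) set" where
  "Z_forms A =
     {\<alpha> \<in> one_forms (tangent_atlas A).
        ext_deriv (tangent_atlas A) \<alpha> = 0 \<and>
        (\<exists>\<mu>\<in>one_forms A. comp_mirror A \<alpha> = pullback (tangent_atlas A) A fst \<mu>)}"

definition E_forms ::
    "('a, 'e::finite_dim_inner) chart set \<Rightarrow>
     ('a \<times> ('a, 'e) tvec \<Rightarrow> ('a \<times> ('a, 'e) tvec, 'e \<times> 'e) tvec \<Rightarrow> real) set" where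
  "E_forms A =
     {differential (tangent_atlas A) (f_form \<nu> c) | \<nu> c.
        \<nu> \<in> one_forms A \<and> c \<in> smooth_functions A}"

end

theory Submission
  imports Defs
begin

text \<open>
  The isomorphism is induced by the restriction \<open>s\<^sup>* : Z \<rightarrow> \<Omega>\<^sup>1(M)\<close> of forms to the zero section
  \<open>s\<close> of the tangent bundle.

  Let $\alpha$ be a closed form on $TM$ with $\alpha \circ B = \pi^*\mu$, so that
  $\alpha = h_i(x, v)\,dx^i + a_i(x)\,dv^i$ with $\mu = a_i\,dx^i$. The $dx^i \wedge dv^j$ components of
  $d\alpha = 0$ say that $\partial h_i / \partial v^j = \partial a_j / \partial x^i$, so that
  $h_i = v^j\,\partial a_j / \partial x^i + c_i(x)$, where $c_i\,dx^i = s^*\alpha$. Globally,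
  $\alpha = df_{\mu,0} + \pi^*(s^*\alpha)$ (\<open>local_form_Z\<close>). Three consequences give the theorem.

  First, $s^*\alpha = dc$ implies $\alpha = df_{\mu,c}$, and conversely $s^*(df_{\nu,c}) = dc$; so
  \<open>E_forms\<close> consists of those elements of \<open>Z_forms\<close> whose restriction is exact (\<open>E_forms_eq\<close>). Second,
  the restriction of a closed form is closed, and each closed $\beta$ on $M$ is the restriction of
  $\pi^*\beta \in Z$; so \<open>Z_forms\<close> is mapped onto the closed forms (\<open>zero_section_Z_forms\<close>).
  Third, $s^*$ is linear, so it identifies the quotients (\<open>quotient_vs_isomorphic\<close>).

  All of this is verified in charts. The notions involved are defined pointwise with the help of
  arbitrarily chosen charts, so the work lies in their independence of this choice, for the exterior
  derivative on $TM$ in particular (\<open>curl_change\<close>): it rests on the symmetry of second derivatives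
  of the transition maps. The functions whose smoothness on $TM$ has to be shown are linear in the fibre
  coordinates, up to a function on $M$; this reduces to smoothness on $M$ by expanding in finitely
  many fibre directions (\<open>linear_family_smooth_on\<close>).
\<close>

section \<open>Functions of class C^k\<close>

abbreviation D :: "('a::real_normed_vector \<Rightarrow> 'b::real_normed_vector) \<Rightarrow> 'a \<Rightarrow> 'a \<Rightarrow> 'b" where
  "D f x \<equiv> frechet_derivative f (at x)"

lemma D_has_derivative: "f differentiable at x \<Longrightarrow> (f has_derivative D f x) (at x)"
  by (simp add: frechet_derivative_works)

lemma D_eqI: "(f has_derivative f') (at x) \<Longrightarrow> D f x = f'"
  by (rule frechet_derivative_at[symmetric])

lemma D_cong:
  assumes "open S" "x \<in> S" "\<And>y. y \<in> S \<Longrightarrow> f y = g y"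
  shows "D f x = D g x"
proof -
  have "(f has_derivative F) (at x) \<longleftrightarrow> (g has_derivative F) (at x)" for F
    using assms by (metis has_derivative_transform_within_open)
  then show ?thesis by (simp add: frechet_derivative_def)
qed

lemma differentiable_cong_open:
  assumes "open S" "x \<in> S" "\<And>y. y \<in> S \<Longrightarrow> f y = g y" "g differentiable at x"
  shows "f differentiable at x"
  using assms by (metis differentiable_def has_derivative_transform_within_open)

lemma linear_D: "f differentiable at x \<Longrightarrow> linear (D f x)"
  using D_has_derivative has_derivative_linear by blast

lemma Ck_on_cong:
  assumes "open S" "\<And>x. x \<in> S \<Longrightarrow> f x = g x"
  shows "Ck_on k f S \<longleftrightarrow> Ck_on k g S"
  using assms(2)
proof (induction k arbitrary: f g)
  case 0
  then show ?case by (simp cong: continuous_on_cong)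
next
  case (Suc k)
  have "D f x = D g x" if "x \<in> S" for x
    using D_cong[OF assms(1) that] Suc.prems by blast
  then have "Ck_on k (\<lambda>x. D f x v) S \<longleftrightarrow> Ck_on k (\<lambda>x. D g x v) S" for v
    by (intro Suc.IH) auto
  moreover have "f differentiable at x \<longleftrightarrow> g differentiable at x" if "x \<in> S" for x
    using differentiable_cong_open[OF assms(1) that] Suc.prems by metis
  ultimately show ?case by auto
qed

lemma smooth_on_cong:
  assumes "open S" "\<And>x. x \<in> S \<Longrightarrow> f x = g x"
  shows "smooth_on f S \<longleftrightarrow> smooth_on g S"
  using Ck_on_cong[OF assms] by (simp add: smooth_on_def)

lemma Ck_on_subset: "Ck_on k f S \<Longrightarrow> T \<subseteq> S \<Longrightarrow> Ck_on k f T"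
  by (induction k arbitrary: f) (auto intro: continuous_on_subset)

lemma smooth_on_subset: "smooth_on f S \<Longrightarrow> T \<subseteq> S \<Longrightarrow> smooth_on f T"
  by (meson smooth_on_def Ck_on_subset)

lemma smooth_on_differentiable: "smooth_on f S \<Longrightarrow> x \<in> S \<Longrightarrow> f differentiable at x"
  unfolding smooth_on_def by (metis Ck_on.simps(2))

lemma smooth_on_D: "smooth_on f S \<Longrightarrow> smooth_on (\<lambda>x. D f x v) S"
  unfolding smooth_on_def by (metis Ck_on.simps(2))

lemma smooth_on_continuous: "smooth_on f S \<Longrightarrow> continuous_on S f"
  unfolding smooth_on_def by (metis Ck_on.simps(1))

lemma Ck_on_const: "Ck_on k (\<lambda>x. c) S"
  by (induction k arbitrary: c) auto

lemma smooth_on_const: "smooth_on (\<lambda>x. c) S"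
  by (simp add: smooth_on_def Ck_on_const)

lemma D_bounded_linear_comp:
  assumes "bounded_linear L" "f differentiable at x"
  shows "D (\<lambda>y. L (f y)) x = (\<lambda>v. L (D f x v))"
  using bounded_linear.has_derivative[OF assms(1) D_has_derivative[OF assms(2)]] by (rule D_eqI)

lemma D_comp_bounded_linear:
  assumes "bounded_linear L" "f differentiable at (L x)"
  shows "D (\<lambda>y. f (L y)) x = (\<lambda>v. D f (L x) (L v))"
  using has_derivative_compose[OF bounded_linear_imp_has_derivative[OF assms(1)]
      D_has_derivative[OF assms(2)]] by (intro D_eqI)

lemma D_add:
  assumes "f differentiable at x" "g differentiable at x"
  shows "D (\<lambda>y. f y + g y) x = (\<lambda>v. D f x v + D g x v)"
  using has_derivative_add[OF assms[THEN D_has_derivative]] by (rule D_eqI)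

lemma D_Pair:
  assumes "f differentiable at x" "g differentiable at x"
  shows "D (\<lambda>y. (f y, g y)) x = (\<lambda>v. (D f x v, D g x v))"
  using has_derivative_Pair[OF assms[THEN D_has_derivative]] by (rule D_eqI)

lemma Ck_on_add:
  assumes "open S" "Ck_on k f S" "Ck_on k g S"
  shows "Ck_on k (\<lambda>x. f x + g x) S"
  using assms(2,3)
proof (induction k arbitrary: f g)
  case 0
  then show ?case by (auto intro: continuous_on_add)
next
  case (Suc k)
  have "Ck_on k (\<lambda>x. D (\<lambda>y. f y + g y) x v) S \<longleftrightarrow> Ck_on k (\<lambda>x. D f x v + D g x v) S" for v
    by (rule Ck_on_cong[OF assms(1)]) (use Suc.prems in \<open>auto simp: D_add\<close>)
  then show ?case using Suc by (auto intro: differentiable_add)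
qed

lemma Ck_on_Pair:
  assumes "open S" "Ck_on k f S" "Ck_on k g S"
  shows "Ck_on k (\<lambda>x. (f x, g x)) S"
  using assms(2,3)
proof (induction k arbitrary: f g)
  case 0
  then show ?case by (auto intro: continuous_on_Pair)
next
  case (Suc k)
  have "Ck_on k (\<lambda>x. D (\<lambda>y. (f y, g y)) x v) S \<longleftrightarrow> Ck_on k (\<lambda>x. (D f x v, D g x v)) S" for v
    by (rule Ck_on_cong[OF assms(1)]) (use Suc.prems in \<open>auto simp: D_Pair\<close>)
  moreover have "(\<lambda>y. (f y, g y)) differentiable at x" if "x \<in> S" for x
    using Suc.prems that has_derivative_Pair unfolding Ck_on.simps differentiable_def by blast
  ultimately show ?case using Suc by auto
qed

lemma Ck_on_bounded_linear_comp:
  assumes "open S" "bounded_linear L" "Ck_on k f S"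
  shows "Ck_on k (\<lambda>x. L (f x)) S"
  using assms(3)
proof (induction k arbitrary: f)
  case 0
  then show ?case using bounded_linear.continuous_on[OF assms(2)] by auto
next
  case (Suc k)
  have "Ck_on k (\<lambda>x. D (\<lambda>y. L (f y)) x v) S \<longleftrightarrow> Ck_on k (\<lambda>x. L (D f x v)) S" for v
    by (rule Ck_on_cong[OF assms(1)]) (use Suc.prems in \<open>auto simp: D_bounded_linear_comp[OF assms(2)]\<close>)
  moreover have "(\<lambda>y. L (f y)) differentiable at x" if "x \<in> S" for x
    using Suc.prems that bounded_linear.has_derivative[OF assms(2)]
    unfolding Ck_on.simps differentiable_def by blast
  ultimately show ?case using Suc by auto
qed

lemma Ck_on_comp_bounded_linear:
  assumes "open S" "bounded_linear L" "Ck_on k f S"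
  shows "Ck_on k (\<lambda>x. f (L x)) (L -` S)"
  using assms(3)
proof (induction k arbitrary: f)
  case 0
  have "continuous_on (L -` S) L"
    using assms(2) linear_continuous_on by blast
  then show ?case using 0 by (auto intro: continuous_on_compose2)
next
  case (Suc k)
  have "open (L -` S)"
    using assms by (intro open_vimage) (simp_all add: linear_continuous_on)
  then have "Ck_on k (\<lambda>x. D (\<lambda>y. f (L y)) x v) (L -` S)
      \<longleftrightarrow> Ck_on k (\<lambda>x. D f (L x) (L v)) (L -` S)" for v
    by (rule Ck_on_cong) (use Suc.prems in \<open>auto simp: D_comp_bounded_linear[OF assms(2)]\<close>)
  moreover have "Ck_on k (\<lambda>x. D f (L x) (L v)) (L -` S)" for v
    using Suc.IH[of "\<lambda>x. D f x (L v)"] Suc.prems by simp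
  moreover have "(\<lambda>y. f (L y)) differentiable at x" if "L x \<in> S" for x
    using Suc.prems that has_derivative_compose[OF bounded_linear_imp_has_derivative[OF assms(2)]]
    unfolding Ck_on.simps differentiable_def by blast
  ultimately show ?case using Suc by auto
qed

lemma smooth_on_add: "open S \<Longrightarrow> smooth_on f S \<Longrightarrow> smooth_on g S \<Longrightarrow> smooth_on (\<lambda>x. f x + g x) S"
  by (simp add: smooth_on_def Ck_on_add)

lemma smooth_on_Pair: "open S \<Longrightarrow> smooth_on f S \<Longrightarrow> smooth_on g S \<Longrightarrow> smooth_on (\<lambda>x. (f x, g x)) S"
  by (simp add: smooth_on_def Ck_on_Pair)

lemma smooth_on_bounded_linear_comp:
  "open S \<Longrightarrow> bounded_linear L \<Longrightarrow> smooth_on f S \<Longrightarrow> smooth_on (\<lambda>x. L (f x)) S"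
  by (simp add: smooth_on_def Ck_on_bounded_linear_comp)

lemma smooth_on_comp_bounded_linear:
  "open S \<Longrightarrow> bounded_linear L \<Longrightarrow> smooth_on f S \<Longrightarrow> smooth_on (\<lambda>x. f (L x)) (L -` S)"
  by (simp add: smooth_on_def Ck_on_comp_bounded_linear)

lemma smooth_on_fst: "open S \<Longrightarrow> smooth_on f S \<Longrightarrow> smooth_on (\<lambda>y. f (fst y)) (S \<times> UNIV)"
  using smooth_on_comp_bounded_linear[OF _ bounded_linear_fst] by (simp add: fst_vimage_eq_Times)

text \<open>
  Dimension \<open>0\<close> is allowed, so the model space has no \<open>Basis\<close>; an orthogonal spanning set
  serves instead. It may contain \<open>0\<close>, whose coordinate is then \<open>0 / 0 = 0\<close>.
\<close>

lemma orthogonal_coordinates: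
  obtains K :: "'a::finite_dim_inner set"
  where "finite K" "\<And>x. x = (\<Sum>k\<in>K. (x \<bullet> k / (k \<bullet> k)) *\<^sub>R k)"
proof -
  obtain B :: "'a set" where B: "finite B" "span B = UNIV"
    using finite_spanning_set unfolding finite_dim_inner_iff by blast
  obtain K :: "'a set" where K: "finite K" "span K = UNIV" "pairwise orthogonal K"
    using basis_orthogonal[OF B(1)] unfolding B(2) by auto
  have "x = (\<Sum>k\<in>K. (x \<bullet> k / (k \<bullet> k)) *\<^sub>R k)" for x
  proof -
    obtain c where c: "x = (\<Sum>k\<in>K. c k *\<^sub>R k)"
      using K(2) span_finite[OF K(1)] by blast
    have "x \<bullet> j = c j * (j \<bullet> j)" if "j \<in> K" for j
    proof -
      have "x \<bullet> j = (\<Sum>k\<in>K. c k * (k \<bullet> j))" by (simp add: c inner_sum_left)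
      also have "\<dots> = (\<Sum>k\<in>K. if k = j then c j * (j \<bullet> j) else 0)"
        using K(3) that by (intro sum.cong) (auto simp: pairwise_def orthogonal_def)
      finally show ?thesis using K(1) that by simp
    qed
    then have "(x \<bullet> k / (k \<bullet> k)) *\<^sub>R k = c k *\<^sub>R k" if "k \<in> K" for k
      using that by simp
    then have "(\<Sum>k\<in>K. (x \<bullet> k / (k \<bullet> k)) *\<^sub>R k) = (\<Sum>k\<in>K. c k *\<^sub>R k)"
      by (rule sum.cong[OF refl])
    then show ?thesis using c by metis
  qed
  then show ?thesis using that K(1) by blast
qed

section \<open>Families of linear maps\<close>

text \<open>
  One finite set of arguments determines all the linear maps \<open>G z\<close> simultaneously, with coefficients
  that do not depend on \<open>z\<close>. Regularity in \<open>z\<close> for fixed \<open>e\<close> therefore becomes joint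
  regularity in \<open>(z, e)\<close>.
\<close>

lemma linear_family_expand:
  fixes G :: "'z \<Rightarrow> 'e::finite_dim_inner \<Rightarrow> 'b::real_vector"
  obtains K :: "'e set"
  where "finite K" "\<And>z e. linear (G z) \<Longrightarrow> G z e = (\<Sum>k\<in>K. (e \<bullet> k / (k \<bullet> k)) *\<^sub>R G z k)"
proof -
  obtain K :: "'e set" where K: "finite K" "\<And>x. x = (\<Sum>k\<in>K. (x \<bullet> k / (k \<bullet> k)) *\<^sub>R k)"
    using orthogonal_coordinates by metis
  have "G z e = (\<Sum>k\<in>K. (e \<bullet> k / (k \<bullet> k)) *\<^sub>R G z k)" if "linear (G z)" for z e
    using arg_cong[OF K(2)[of e], of "G z"] that by (simp add: linear_sum linear_cmul)
  then show ?thesis using that K(1) by blast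
qed

lemma linear_family_has_derivative:
  fixes G :: "'z::finite_dim_inner \<Rightarrow> 'e::finite_dim_inner \<Rightarrow> 'b::real_normed_vector"
  assumes S: "open S" "z \<in> S" and lin: "\<And>z. z \<in> S \<Longrightarrow> linear (G z)"
    and diff: "\<And>e. (\<lambda>z. G z e) differentiable at z"
  shows "((\<lambda>(z, e). G z e) has_derivative (\<lambda>(b, c). D (\<lambda>z. G z e) z b + G z c)) (at (z, e))"
proof -
  obtain K :: "'e set" where K: "finite K"
    "\<And>z e. linear (G z) \<Longrightarrow> G z e = (\<Sum>k\<in>K. (e \<bullet> k / (k \<bullet> k)) *\<^sub>R G z k)"
    using linear_family_expand[of G] by metis
  let ?c = "\<lambda>e k. e \<bullet> k / (k \<bullet> k)"
  have D_e: "D (\<lambda>z. G z e) z b = (\<Sum>k\<in>K. ?c e k *\<^sub>R D (\<lambda>z. G z k) z b)" for b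
  proof -
    have "((\<lambda>z. \<Sum>k\<in>K. ?c e k *\<^sub>R G z k) has_derivative
        (\<lambda>b. \<Sum>k\<in>K. ?c e k *\<^sub>R D (\<lambda>z. G z k) z b)) (at z)"
      by (intro has_derivative_sum has_derivative_scaleR_right D_has_derivative diff)
    then have "D (\<lambda>z. \<Sum>k\<in>K. ?c e k *\<^sub>R G z k) z = (\<lambda>b. \<Sum>k\<in>K. ?c e k *\<^sub>R D (\<lambda>z. G z k) z b)"
      by (rule D_eqI)
    then show ?thesis
      using D_cong[OF S, of "\<lambda>z. G z e" "\<lambda>z. \<Sum>k\<in>K. ?c e k *\<^sub>R G z k"] K(2)[OF lin] by simp
  qed
  have "((\<lambda>y. \<Sum>k\<in>K. ?c (snd y) k *\<^sub>R G (fst y) k) has_derivative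
      (\<lambda>y. \<Sum>k\<in>K. ?c e k *\<^sub>R D (\<lambda>z. G z k) z (fst y) + ?c (snd y) k *\<^sub>R G z k)) (at (z, e))"
  proof (rule has_derivative_sum)
    fix k assume "k \<in> K"
    have "((\<lambda>y. ?c (snd y) k) has_derivative (\<lambda>y. ?c (snd y) k)) (at (z, e))"
      unfolding divide_inverse
      by (intro bounded_linear_imp_has_derivative bounded_linear_intros)
    moreover have "((\<lambda>y. G (fst y) k) has_derivative (\<lambda>y. D (\<lambda>z. G z k) z (fst y))) (at (z, e))"
      using has_derivative_compose[OF bounded_linear_imp_has_derivative[OF bounded_linear_fst],
          of "\<lambda>z. G z k" _ "(z, e)"] D_has_derivative[OF diff] by simp
    ultimately show "((\<lambda>y. ?c (snd y) k *\<^sub>R G (fst y) k) has_derivative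
      (\<lambda>y. ?c e k *\<^sub>R D (\<lambda>z. G z k) z (fst y) + ?c (snd y) k *\<^sub>R G z k)) (at (z, e))"
      using has_derivative_scaleR by fastforce
  qed
  moreover have "(\<Sum>k\<in>K. ?c e k *\<^sub>R D (\<lambda>z. G z k) z (fst y) + ?c (snd y) k *\<^sub>R G z k)
      = (\<lambda>(b, c). D (\<lambda>z. G z e) z b + G z c) y" for y
    using K(2)[OF lin[OF S(2)], of "snd y"] by (simp add: D_e sum.distrib case_prod_beta)
  ultimately have "((\<lambda>y. \<Sum>k\<in>K. ?c (snd y) k *\<^sub>R G (fst y) k) has_derivative
      (\<lambda>(b, c). D (\<lambda>z. G z e) z b + G z c)) (at (z, e))"
    by simp
  then show ?thesis
  proof (rule has_derivative_transform_within_open)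
    show "open (S \<times> (UNIV :: 'e set))" using S(1) by (simp add: open_Times)
  qed (use S lin K(2) in auto)
qed

text \<open>
  The derivative in direction \<open>(b, c)\<close> is \<open>D (\<lambda>z. G z e) z b + G z c\<close>. Its first summand is
  again a family of linear maps in \<open>e\<close>, of class one lower, and its second summand is a function
  of \<open>z\<close> alone; this makes induction on \<open>k\<close> work.
\<close>

lemma linear_family_Ck_on:
  fixes G :: "'z::finite_dim_inner \<Rightarrow> 'e::finite_dim_inner \<Rightarrow> 'b::real_normed_vector"
  assumes S: "open S" and lin: "\<And>z. z \<in> S \<Longrightarrow> linear (G z)"
    and Ck: "\<And>e. Ck_on k (\<lambda>z. G z e) S"
  shows "Ck_on k (\<lambda>(z, e). G z e) (S \<times> UNIV)"
  using lin Ck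
proof (induction k arbitrary: G)
  case 0
  obtain K :: "'e set" where K: "finite K"
    "\<And>z e. linear (G z) \<Longrightarrow> G z e = (\<Sum>k\<in>K. (e \<bullet> k / (k \<bullet> k)) *\<^sub>R G z k)"
    using linear_family_expand[of G] by metis
  have "continuous_on (S \<times> UNIV) (\<lambda>y. G (fst y) k)" for k
    using 0(2)[of k] by (auto intro!: continuous_on_compose2[of S "\<lambda>z. G z k"] continuous_on_fst)
  then have "continuous_on (S \<times> UNIV)
      (\<lambda>y. \<Sum>k\<in>K. (snd y \<bullet> k / (k \<bullet> k)) *\<^sub>R G (fst y) k)"
    unfolding divide_inverse by (intro continuous_intros)
  moreover have "(\<lambda>(z, e). G z e) y = (\<Sum>k\<in>K. (snd y \<bullet> k / (k \<bullet> k)) *\<^sub>R G (fst y) k)"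
    if "y \<in> S \<times> UNIV" for y
    using that K(2)[OF 0(1), of "fst y" "snd y"] by (auto simp: case_prod_beta)
  ultimately show ?case by (simp cong: continuous_on_cong)
next
  case (Suc k)
  let ?F = "\<lambda>(z, e). G z e"
  have diff: "(\<lambda>z. G z e) differentiable at z" if "z \<in> S" for z e
    using Suc.prems(2)[of e] that by simp
  have der: "(?F has_derivative (\<lambda>(b, c). D (\<lambda>z. G z e) z b + G z c)) (at (z, e))"
    if "z \<in> S" for z e
    using linear_family_has_derivative[OF S that Suc.prems(1) diff[OF that]] .
  have op: "open (S \<times> (UNIV :: 'e set))" using S by (simp add: open_Times)
  have "Ck_on k (\<lambda>y. D ?F y (b, c)) (S \<times> UNIV)" for b c
  proof -
    have "linear (\<lambda>e. D (\<lambda>z. G z e) z b)" if z: "z \<in> S" for z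
    proof (rule linearI)
      fix e e' :: 'e and r :: real
      have "D (\<lambda>z. G z (e + e')) z = D (\<lambda>z. G z e + G z e') z"
        by (rule D_cong[OF S z]) (simp add: linear_add Suc.prems(1))
      then show "D (\<lambda>z. G z (e + e')) z b = D (\<lambda>z. G z e) z b + D (\<lambda>z. G z e') z b"
        by (simp add: D_add diff z)
      have "D (\<lambda>z. G z (r *\<^sub>R e)) z = D (\<lambda>z. r *\<^sub>R G z e) z"
        by (rule D_cong[OF S z]) (simp add: linear_cmul Suc.prems(1))
      then show "D (\<lambda>z. G z (r *\<^sub>R e)) z b = r *\<^sub>R D (\<lambda>z. G z e) z b"
        by (simp add: D_bounded_linear_comp[OF bounded_linear_scaleR_right] diff z)
    qed
    then have 1: "Ck_on k (\<lambda>(z, e). D (\<lambda>z. G z e) z b) (S \<times> UNIV)"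
      using Suc.prems(2) by (intro Suc.IH) auto
    have "Ck_on k (\<lambda>z. G z c) S"
    proof -
      have "Ck_on j f S" if "Ck_on (Suc j) f S" for j and f :: "'z \<Rightarrow> 'b"
        using that
      proof (induction j arbitrary: f)
        case 0
        then show ?case
          by (auto intro!: continuous_at_imp_continuous_on differentiable_imp_continuous_within)
      qed auto
      then show ?thesis using Suc.prems(2) by blast
    qed
    then have 2: "Ck_on k (\<lambda>y. G (fst y) c) (S \<times> (UNIV :: 'e set))"
      using Ck_on_comp_bounded_linear[OF S bounded_linear_fst] by (simp add: fst_vimage_eq_Times)
    have "Ck_on k (\<lambda>y. (\<lambda>(z, e). D (\<lambda>z. G z e) z b) y + G (fst y) c) (S \<times> UNIV)"
      using Ck_on_add[OF op 1 2] .
    moreover have "D ?F y (b, c) = (\<lambda>(z, e). D (\<lambda>z. G z e) z b) y + G (fst y) c"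
      if "y \<in> S \<times> UNIV" for y
      using D_eqI[OF der, of "fst y" "snd y"] that by (auto simp: case_prod_beta)
    ultimately show ?thesis
      by (subst Ck_on_cong[OF op]) assumption+
  qed
  moreover have "?F differentiable at y" if "y \<in> S \<times> UNIV" for y
    using der[of "fst y" "snd y"] that by (auto simp: differentiable_def)
  ultimately show ?case by simp
qed

lemma linear_family_smooth_on:
  fixes G :: "'z::finite_dim_inner \<Rightarrow> 'e::finite_dim_inner \<Rightarrow> 'b::real_normed_vector"
  assumes "open S" "\<And>z. z \<in> S \<Longrightarrow> linear (G z)" "\<And>e. smooth_on (\<lambda>z. G z e) S"
  shows "smooth_on (\<lambda>(z, e). G z e) (S \<times> UNIV)"
  using linear_family_Ck_on[OF assms(1,2)] assms(3) by (simp add: smooth_on_def)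

section \<open>Symmetry of second derivatives\<close>

lemma line_has_derivative:
  fixes f :: "'a::real_normed_vector \<Rightarrow> real"
  assumes "f differentiable at (p + s *\<^sub>R v)"
  shows "((\<lambda>s. f (p + s *\<^sub>R v)) has_real_derivative D f (p + s *\<^sub>R v) v) (at s)"
proof -
  have "((\<lambda>s. p + s *\<^sub>R v) has_derivative (\<lambda>h. h *\<^sub>R v)) (at s)"
    by (auto intro!: derivative_eq_intros)
  from has_derivative_compose[OF this D_has_derivative[OF assms]]
  have "((\<lambda>s. f (p + s *\<^sub>R v)) has_derivative (\<lambda>h. D f (p + s *\<^sub>R v) (h *\<^sub>R v))) (at s)" .
  then show ?thesis
    using linear_cmul[OF linear_D[OF assms]]
    by (simp add: has_field_derivative_def mult.commute[of _ "D f (p + s *\<^sub>R v) v"])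
qed

text \<open>
  The mean value theorem is used twice: in direction \<open>v\<close>, for the difference of \<open>f\<close> along two
  parallel edges, and then in direction \<open>w\<close>, for the derivative of \<open>f\<close> along \<open>v\<close>.
\<close>

lemma second_difference:
  fixes f :: "'a::finite_dim_inner \<Rightarrow> real"
  assumes f: "smooth_on f S" and t: "t > 0"
    and par: "\<And>r s. 0 \<le> r \<Longrightarrow> r \<le> t \<Longrightarrow> 0 \<le> s \<Longrightarrow> s \<le> t \<Longrightarrow> x + r *\<^sub>R v + s *\<^sub>R w \<in> S"
  obtains r s where "0 \<le> r" "r \<le> t" "0 \<le> s" "s \<le> t"
    "f (x + t *\<^sub>R v + t *\<^sub>R w) - f (x + t *\<^sub>R v) - f (x + t *\<^sub>R w) + f x
       = t * t * D (\<lambda>y. D f y v) (x + r *\<^sub>R v + s *\<^sub>R w) w"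
proof -
  define g where "g = (\<lambda>r. f ((x + t *\<^sub>R w) + r *\<^sub>R v) - f (x + r *\<^sub>R v))"
  have g': "(g has_real_derivative D f ((x + t *\<^sub>R w) + r *\<^sub>R v) v - D f (x + r *\<^sub>R v) v) (at r)"
    if "0 \<le> r" "r \<le> t" for r
    unfolding g_def using that t par[of r t] par[of r 0]
    by (intro derivative_intros line_has_derivative smooth_on_differentiable[OF f])
      (simp_all add: algebra_simps)
  obtain r where r: "0 < r" "r < t"
    "g t - g 0 = (t - 0) * (D f ((x + t *\<^sub>R w) + r *\<^sub>R v) v - D f (x + r *\<^sub>R v) v)"
    using MVT2[OF t g'] by auto
  define h where "h = (\<lambda>s. D f ((x + r *\<^sub>R v) + s *\<^sub>R w) v)"
  have h': "(h has_real_derivative D (\<lambda>y. D f y v) ((x + r *\<^sub>R v) + s *\<^sub>R w) w) (at s)"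
    if "0 \<le> s" "s \<le> t" for s
    unfolding h_def using that r par[of r s]
    by (intro line_has_derivative smooth_on_differentiable[OF smooth_on_D[OF f]]) simp_all
  obtain s where s: "0 < s" "s < t"
    "h t - h 0 = (t - 0) * D (\<lambda>y. D f y v) ((x + r *\<^sub>R v) + s *\<^sub>R w) w"
    using MVT2[OF t h'] by auto
  have "g t - g 0 = t * (h t - h 0)"
    using r(3) by (simp add: h_def algebra_simps)
  then have "f (x + t *\<^sub>R v + t *\<^sub>R w) - f (x + t *\<^sub>R v) - f (x + t *\<^sub>R w) + f x
       = t * t * D (\<lambda>y. D f y v) (x + r *\<^sub>R v + s *\<^sub>R w) w"
    using s(3) by (simp add: g_def algebra_simps)
  then show ?thesis using that[of r s] r s by simp
qed

text \<open>
  The second difference is symmetric in \<open>v\<close> and \<open>w\<close>, so any small parallelogram at \<open>x\<close>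
  contains two points at which the two mixed derivatives have the same value; by continuity they
  agree at \<open>x\<close>.
\<close>

lemma symmetric_second_derivative_real:
  fixes f :: "'a::finite_dim_inner \<Rightarrow> real"
  assumes f: "smooth_on f S" and S: "open S" "x \<in> S"
  shows "D (\<lambda>y. D f y v) x w = D (\<lambda>y. D f y w) x v"
proof (rule ccontr)
  define F where "F = (\<lambda>v w y. D (\<lambda>y. D f y v) y w)"
  assume neq: "\<not> ?thesis"
  define \<epsilon> where "\<epsilon> = \<bar>F v w x - F w v x\<bar> / 2"
  have \<epsilon>: "\<epsilon> > 0" using neq by (simp add: \<epsilon>_def F_def)
  have "isCont (F a b) x" for a b
    unfolding F_def
    using smooth_on_continuous[OF smooth_on_D[OF smooth_on_D[OF f]]] S
    by (simp add: continuous_on_eq_continuous_at)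
  then have "\<forall>\<^sub>F y in nhds x. dist (F a b y) (F a b x) < \<epsilon>" for a b
    using \<epsilon> by (metis isCont_def tendsto_at_iff_tendsto_nhds tendstoD)
  then have "\<forall>\<^sub>F y in nhds x. y \<in> S \<and> dist (F v w y) (F v w x) < \<epsilon> \<and> dist (F w v y) (F w v x) < \<epsilon>"
    using eventually_nhds_in_open[OF S] by (intro eventually_conj)
  then obtain d where d: "d > 0" "\<And>y. dist y x < d \<Longrightarrow>
      y \<in> S \<and> dist (F v w y) (F v w x) < \<epsilon> \<and> dist (F w v y) (F w v x) < \<epsilon>"
    unfolding eventually_nhds_metric by blast
  (* small enough for the parallelogram spanned by t v and t w to stay within d of x; the
     summand 1 covers v = w = 0 *)
  define t where "t = d / (2 * (norm v + norm w + 1))"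
  have pos: "norm v + norm w + 1 > 0" by (simp add: add_nonneg_pos)
  have t: "t > 0" unfolding t_def using d(1) pos by simp
  have near: "dist (x + r *\<^sub>R a + s *\<^sub>R b) x < d"
    if "0 \<le> r" "r \<le> t" "0 \<le> s" "s \<le> t" "norm a + norm b = norm v + norm w" for r s a b
  proof -
    have "dist (x + r *\<^sub>R a + s *\<^sub>R b) x = norm (r *\<^sub>R a + s *\<^sub>R b)" by (simp add: dist_norm algebra_simps)
    also have "\<dots> \<le> r * norm a + s * norm b"
      using norm_triangle_ineq[of "r *\<^sub>R a" "s *\<^sub>R b"] that by simp
    also have "\<dots> \<le> t * norm a + t * norm b"
      using that by (intro add_mono mult_right_mono) auto
    also have "\<dots> = t * (norm v + norm w)" using that(5) by (metis distrib_left)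
    also have "\<dots> < t * (2 * (norm v + norm w + 1))"
      using t by (simp add: add_nonneg_pos)
    also have "\<dots> = d" unfolding t_def using pos by simp
    finally show ?thesis .
  qed
  obtain r s where rs: "0 \<le> r" "r \<le> t" "0 \<le> s" "s \<le> t"
    "f (x + t *\<^sub>R v + t *\<^sub>R w) - f (x + t *\<^sub>R v) - f (x + t *\<^sub>R w) + f x
       = t * t * F v w (x + r *\<^sub>R v + s *\<^sub>R w)"
    using second_difference[OF f t, of x v w] near d(2) unfolding F_def by metis
  obtain r' s' where rs': "0 \<le> r'" "r' \<le> t" "0 \<le> s'" "s' \<le> t"
    "f (x + t *\<^sub>R w + t *\<^sub>R v) - f (x + t *\<^sub>R w) - f (x + t *\<^sub>R v) + f x
       = t * t * F w v (x + r' *\<^sub>R w + s' *\<^sub>R v)"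
    using second_difference[OF f t, of x w v] near[of _ _ w v] d(2) unfolding F_def
    by (metis add.commute)
  have "t * t * F v w (x + r *\<^sub>R v + s *\<^sub>R w) = t * t * F w v (x + r' *\<^sub>R w + s' *\<^sub>R v)"
    using rs(5) rs'(5) by (simp add: algebra_simps)
  then have "F v w (x + r *\<^sub>R v + s *\<^sub>R w) = F w v (x + r' *\<^sub>R w + s' *\<^sub>R v)"
    using t by simp
  moreover have "dist (F v w (x + r *\<^sub>R v + s *\<^sub>R w)) (F v w x) < \<epsilon>"
    using d(2) near[OF rs(1-4)] by simp
  moreover have "dist (F w v (x + r' *\<^sub>R w + s' *\<^sub>R v)) (F w v x) < \<epsilon>"
    using d(2) near[OF rs'(1-4), of w v] by simp
  ultimately have "\<bar>F v w x - F w v x\<bar> < 2 * \<epsilon>"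
    unfolding dist_real_def by linarith
  then show False by (simp add: \<epsilon>_def)
qed

lemma symmetric_second_derivative:
  fixes f :: "'a::finite_dim_inner \<Rightarrow> 'b::real_inner"
  assumes f: "smooth_on f S" and S: "open S" "x \<in> S"
  shows "D (\<lambda>y. D f y v) x w = D (\<lambda>y. D f y w) x v"
proof -
  have *: "D (\<lambda>y. D (\<lambda>y. f y \<bullet> c) y a) x b = D (\<lambda>y. D f y a) x b \<bullet> c" for a b c
  proof -
    have "D (\<lambda>y. D (\<lambda>y. f y \<bullet> c) y a) x = D (\<lambda>y. D f y a \<bullet> c) x"
      by (rule D_cong[OF S])
        (simp add: D_bounded_linear_comp[OF bounded_linear_inner_left] smooth_on_differentiable[OF f])
    then show ?thesis
      by (simp add: D_bounded_linear_comp[OF bounded_linear_inner_left]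
          smooth_on_differentiable[OF smooth_on_D[OF f]] S)
  qed
  have "smooth_on (\<lambda>y. f y \<bullet> c) S" for c
    using smooth_on_bounded_linear_comp[OF S(1) bounded_linear_inner_left f] .
  from symmetric_second_derivative_real[OF this S]
  have "D (\<lambda>y. D f y v) x w \<bullet> c = D (\<lambda>y. D f y w) x v \<bullet> c" for c
    unfolding * .
  then show ?thesis by (metis vector_eq_rdot)
qed

section \<open>Smooth atlases\<close>

lemma chart_map_inv: "x \<in> chart_image \<phi> \<Longrightarrow> chart_map \<phi> (chart_inv \<phi> x) = x"
  by (simp add: chart_image_def chart_inv_def f_inv_into_f)

lemma chart_inv_in_dom: "x \<in> chart_image \<phi> \<Longrightarrow> chart_inv \<phi> x \<in> chart_dom \<phi>"
  by (simp add: chart_image_def chart_inv_def inv_into_into)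

lemma chart_map_in_image: "p \<in> chart_dom \<phi> \<Longrightarrow> chart_map \<phi> p \<in> chart_image \<phi>"
  by (simp add: chart_image_def)

lemma ball_chart_image: "(\<forall>x\<in>chart_image \<phi>. P x) \<longleftrightarrow> (\<forall>p\<in>chart_dom \<phi>. P (chart_map \<phi> p))"
  by (simp add: chart_image_def)

lemma in_charts_at: "\<phi> \<in> charts_at A p \<longleftrightarrow> \<phi> \<in> A \<and> p \<in> chart_dom \<phi>"
  by (simp add: charts_at_def)

lemma some_chart_in: "p \<in> points A \<Longrightarrow> some_chart A p \<in> charts_at A p"
  unfolding some_chart_def by (rule someI_ex) (auto simp: points_def charts_at_def)

abbreviation overlap :: "('a, 'e) chart \<Rightarrow> ('a, 'e) chart \<Rightarrow> 'e set" where
  "overlap \<phi> \<psi> \<equiv> chart_map \<phi> ` (chart_dom \<phi> \<inter> chart_dom \<psi>)"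

abbreviation jac ::
    "('a, 'e::finite_dim_inner) chart \<Rightarrow> ('a, 'e) chart \<Rightarrow> 'a \<Rightarrow> 'e \<Rightarrow> 'e" where
  "jac \<phi> \<psi> p \<equiv> D (transition \<phi> \<psi>) (chart_map \<phi> p)"

text \<open>
  What differential calculus uses of a manifold. The atlas of \<open>M\<close> and the induced atlas of \<open>TM\<close>
  both satisfy it, so all that follows applies to forms on either of them.
\<close>

locale smooth_atlas =
  fixes A :: "('a, 'e::finite_dim_inner) chart set"
  assumes inj_chart: "\<phi> \<in> A \<Longrightarrow> inj_on (chart_map \<phi>) (chart_dom \<phi>)"
    and open_overlap: "\<phi> \<in> A \<Longrightarrow> \<psi> \<in> A \<Longrightarrow> open (overlap \<phi> \<psi>)"
    and smooth_transition: "\<phi> \<in> A \<Longrightarrow> \<psi> \<in> A \<Longrightarrow> smooth_on (transition \<phi> \<psi>) (overlap \<phi> \<psi>)"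
begin

lemma open_chart_image: "\<phi> \<in> A \<Longrightarrow> open (chart_image \<phi>)"
  using open_overlap[of \<phi> \<phi>] by (simp add: chart_image_def)

lemma chart_inv_map: "\<phi> \<in> A \<Longrightarrow> p \<in> chart_dom \<phi> \<Longrightarrow> chart_inv \<phi> (chart_map \<phi> p) = p"
  by (simp add: chart_inv_def inj_chart)

lemma transition_map:
  "\<phi> \<in> A \<Longrightarrow> p \<in> chart_dom \<phi> \<Longrightarrow> transition \<phi> \<psi> (chart_map \<phi> p) = chart_map \<psi> p"
  by (simp add: transition_def chart_inv_map)

lemma transition_differentiable:
  "\<phi> \<in> charts_at A p \<Longrightarrow> \<psi> \<in> charts_at A p \<Longrightarrow>
    transition \<phi> \<psi> differentiable at (chart_map \<phi> p)"
  using smooth_on_differentiable[OF smooth_transition] by (auto simp: in_charts_at)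

lemma transition_has_derivative:
  "\<phi> \<in> charts_at A p \<Longrightarrow> \<psi> \<in> charts_at A p \<Longrightarrow>
    (transition \<phi> \<psi> has_derivative jac \<phi> \<psi> p) (at (chart_map \<phi> p))"
  by (rule D_has_derivative[OF transition_differentiable])

lemma linear_jac: "\<phi> \<in> charts_at A p \<Longrightarrow> \<psi> \<in> charts_at A p \<Longrightarrow> linear (jac \<phi> \<psi> p)"
  by (simp add: linear_D transition_differentiable)

lemma jac_self:
  assumes "\<phi> \<in> charts_at A p"
  shows "jac \<phi> \<phi> p a = a"
proof -
  have "D (transition \<phi> \<phi>) (chart_map \<phi> p) = D (\<lambda>x. x) (chart_map \<phi> p)"
    using assms by (intro D_cong[OF open_chart_image[of \<phi>]])
      (auto simp: in_charts_at transition_def chart_map_inv chart_map_in_image)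
  then show ?thesis by simp
qed

text \<open>
  The chain rule for \<open>f \<circ> chart_inv \<phi> = (f \<circ> chart_inv \<psi>) \<circ> transition \<phi> \<psi>\<close>, an
  equation that holds on the overlap only.
\<close>

lemma D_change_chart:
  assumes \<phi>: "\<phi> \<in> charts_at A p" and \<psi>: "\<psi> \<in> charts_at A p"
    and f: "(f \<circ> chart_inv \<psi>) differentiable at (chart_map \<psi> p)"
  shows "D (f \<circ> chart_inv \<phi>) (chart_map \<phi> p) a = D (f \<circ> chart_inv \<psi>) (chart_map \<psi> p) (jac \<phi> \<psi> p a)"
    and "(f \<circ> chart_inv \<phi>) differentiable at (chart_map \<phi> p)"
proof -
  have A: "\<phi> \<in> A" "\<psi> \<in> A" "p \<in> chart_dom \<phi>" "p \<in> chart_dom \<psi>"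
    using \<phi> \<psi> by (auto simp: in_charts_at)
  have "((\<lambda>x. (f \<circ> chart_inv \<psi>) (transition \<phi> \<psi> x)) has_derivative
      (\<lambda>a. D (f \<circ> chart_inv \<psi>) (chart_map \<psi> p) (jac \<phi> \<psi> p a))) (at (chart_map \<phi> p))"
    using has_derivative_compose[OF transition_has_derivative[OF \<phi> \<psi>]] D_has_derivative[OF f] A
    unfolding transition_map[OF A(1,3)] by blast
  then have der: "((f \<circ> chart_inv \<phi>) has_derivative
      (\<lambda>a. D (f \<circ> chart_inv \<psi>) (chart_map \<psi> p) (jac \<phi> \<psi> p a))) (at (chart_map \<phi> p))"
    using A by (elim has_derivative_transform_within_open[OF _ open_overlap[OF A(1,2)]])
      (auto simp: transition_map chart_inv_map)
  then show "D (f \<circ> chart_inv \<phi>) (chart_map \<phi> p) a = D (f \<circ> chart_inv \<psi>) (chart_map \<psi> p) (jac \<phi> \<psi> p a)"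
    and "(f \<circ> chart_inv \<phi>) differentiable at (chart_map \<phi> p)"
    using der by (simp add: D_eqI, auto simp: differentiable_def)
qed

lemma jac_chain:
  assumes "\<phi> \<in> charts_at A p" "\<psi> \<in> charts_at A p" "\<xi> \<in> charts_at A p"
  shows "jac \<psi> \<xi> p (jac \<phi> \<psi> p a) = jac \<phi> \<xi> p a"
  using D_change_chart(1)[OF assms(1,2), of "chart_map \<xi>" a] transition_differentiable[OF assms(2,3)]
  by (simp add: transition_def)

section \<open>Tangent vectors in charts\<close>

lemma tvec_of_apply: "\<psi> \<in> charts_at A p \<Longrightarrow> tvec_of A \<phi> p a \<psi> = jac \<phi> \<psi> p a"
  by (simp add: tvec_of_def)

lemma tvec_of_apply_self: "\<phi> \<in> charts_at A p \<Longrightarrow> tvec_of A \<phi> p a \<phi> = a"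
  by (simp add: tvec_of_apply jac_self)

lemma tvec_of_in_tangent_space: "\<phi> \<in> charts_at A p \<Longrightarrow> tvec_of A \<phi> p a \<in> tangent_space A p"
  by (simp add: tangent_space_def tvec_of_apply jac_chain) (simp add: tvec_of_def)

lemma tvec_of_components:
  assumes "\<phi> \<in> charts_at A p" "v \<in> tangent_space A p"
  shows "tvec_of A \<phi> p (v \<phi>) = v"
proof
  fix \<psi>
  show "tvec_of A \<phi> p (v \<phi>) \<psi> = v \<psi>"
  proof (cases "\<psi> \<in> charts_at A p")
    case True
    then have "v \<psi> = jac \<phi> \<psi> p (v \<phi>)" using assms unfolding tangent_space_def by blast
    then show ?thesis using True by (simp only: tvec_of_def if_True)
  next
    case False
    then have "v \<psi> = 0" using assms unfolding tangent_space_def by blast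
    then show ?thesis using False by (simp only: tvec_of_def if_False)
  qed
qed

lemma tvec_of_change:
  assumes "\<phi> \<in> charts_at A p" "\<psi> \<in> charts_at A p"
  shows "tvec_of A \<phi> p a = tvec_of A \<psi> p (jac \<phi> \<psi> p a)"
  using tvec_of_components[OF assms(2) tvec_of_in_tangent_space[OF assms(1)]] assms(2)
  by (simp add: tvec_of_apply)

lemma tvec_of_add:
  assumes "\<phi> \<in> charts_at A p"
  shows "tvec_of A \<phi> p (a + b) = tvec_of A \<phi> p a + tvec_of A \<phi> p b"
  using linear_add[OF linear_jac[OF assms]] by (auto simp: fun_eq_iff tvec_of_def)

lemma tvec_of_scaleR:
  assumes "\<phi> \<in> charts_at A p"
  shows "tvec_of A \<phi> p (r *\<^sub>R a) = r *\<^sub>R tvec_of A \<phi> p a"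
  using linear_cmul[OF linear_jac[OF assms]] by (auto simp: fun_eq_iff tvec_of_def scaleR_fun_def)

lemma tvec_of_surj:
  assumes "\<phi> \<in> charts_at A p" "v \<in> tangent_space A p"
  shows "\<exists>a. v = tvec_of A \<phi> p a"
  using tvec_of_components[OF assms] by metis

lemma zero_in_tangent_space: "p \<in> points A \<Longrightarrow> 0 \<in> tangent_space A p"
  using linear_0[OF linear_jac] by (auto simp: tangent_space_def)

section \<open>One-forms in charts\<close>

lemma local_form_map:
  "\<phi> \<in> charts_at A p \<Longrightarrow> local_form A \<alpha> \<phi> (chart_map \<phi> p) a = \<alpha> p (tvec_of A \<phi> p a)"
  by (simp add: local_form_def in_charts_at chart_inv_map)

lemma local_form_change:
  assumes "\<phi> \<in> charts_at A p" "\<psi> \<in> charts_at A p"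
  shows "local_form A \<alpha> \<phi> (chart_map \<phi> p) a
    = local_form A \<alpha> \<psi> (chart_map \<psi> p) (jac \<phi> \<psi> p a)"
  using assms tvec_of_change[OF assms] by (simp add: local_form_map)

text \<open>
  Every tangent vector at a point of a chart domain is the one with some components in that chart,
  so a form is determined by its local forms.
\<close>

lemma form_eqI:
  assumes "\<And>p v. \<not> (p \<in> points A \<and> v \<in> tangent_space A p) \<Longrightarrow> \<alpha> p v = 0"
    and "\<And>p v. \<not> (p \<in> points A \<and> v \<in> tangent_space A p) \<Longrightarrow> \<beta> p v = 0"
    and eq: "\<And>\<phi> x a. \<phi> \<in> A \<Longrightarrow> x \<in> chart_image \<phi> \<Longrightarrow> local_form A \<alpha> \<phi> x a = local_form A \<beta> \<phi> x a"
  shows "\<alpha> = \<beta>"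
proof (intro ext)
  fix p v
  show "\<alpha> p v = \<beta> p v"
  proof (cases "p \<in> points A \<and> v \<in> tangent_space A p")
    case True
    then obtain \<phi> where \<phi>: "\<phi> \<in> charts_at A p" using some_chart_in[of p A] by blast
    with True obtain a where "v = tvec_of A \<phi> p a" using tvec_of_surj[of \<phi> p v] by blast
    then show ?thesis
      using eq[of \<phi> "chart_map \<phi> p" a] \<phi> by (simp add: in_charts_at local_form_map chart_map_in_image)
  qed (use assms in auto)
qed

text \<open>
  Linearity on tangent spaces becomes linearity in the components, which turns membership in
  \<open>one_forms\<close> into a condition on local forms only.
\<close>

lemma one_forms_iff:
  "\<alpha> \<in> one_forms A \<longleftrightarrow>
    (\<forall>p v. \<not> (p \<in> points A \<and> v \<in> tangent_space A p) \<longrightarrow> \<alpha> p v = 0) \<and>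
    (\<forall>\<phi>\<in>A. \<forall>x\<in>chart_image \<phi>. linear (local_form A \<alpha> \<phi> x)) \<and>
    (\<forall>\<phi>\<in>A. \<forall>a. smooth_on (\<lambda>x. local_form A \<alpha> \<phi> x a) (chart_image \<phi>))"
    (is "_ \<longleftrightarrow> ?Z \<and> ?L \<and> ?S")
proof -
  have "(\<forall>p\<in>points A. \<forall>v\<in>tangent_space A p. \<forall>w\<in>tangent_space A p. \<alpha> p (v + w) = \<alpha> p v + \<alpha> p w) \<and>
    (\<forall>p\<in>points A. \<forall>v\<in>tangent_space A p. \<forall>r. \<alpha> p (r *\<^sub>R v) = r * \<alpha> p v) \<longleftrightarrow> ?L" (is "?B \<longleftrightarrow> _")
  proof
    assume B: ?B
    show ?L
      unfolding ball_chart_image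
    proof (intro ballI)
      fix \<phi> p assume "\<phi> \<in> A" "p \<in> chart_dom \<phi>"
      then have \<phi>: "\<phi> \<in> charts_at A p" "p \<in> points A" by (auto simp: in_charts_at points_def)
      then show "linear (local_form A \<alpha> \<phi> (chart_map \<phi> p))"
        using B by (intro linearI)
          (simp_all add: local_form_map tvec_of_add tvec_of_scaleR tvec_of_in_tangent_space)
    qed
  next
    assume L: ?L
    have *: "\<alpha> p (v + w) = \<alpha> p v + \<alpha> p w \<and> \<alpha> p (r *\<^sub>R v) = r * \<alpha> p v"
      if p: "p \<in> points A" and v: "v \<in> tangent_space A p" and w: "w \<in> tangent_space A p" for p v w r
    proof -
      obtain \<phi> where \<phi>: "\<phi> \<in> charts_at A p" using some_chart_in[OF p] by blast
      obtain a b where "v = tvec_of A \<phi> p a" "w = tvec_of A \<phi> p b"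
        using tvec_of_surj[OF \<phi> v] tvec_of_surj[OF \<phi> w] by blast
      moreover have "linear (local_form A \<alpha> \<phi> (chart_map \<phi> p))"
        using L \<phi> by (auto simp: in_charts_at chart_map_in_image)
      from linear_add[OF this] linear_cmul[OF this]
      have "\<alpha> p (tvec_of A \<phi> p (a + b)) = \<alpha> p (tvec_of A \<phi> p a) + \<alpha> p (tvec_of A \<phi> p b)"
        "\<alpha> p (tvec_of A \<phi> p (r *\<^sub>R a)) = r * \<alpha> p (tvec_of A \<phi> p a)"
        using \<phi> by (simp_all add: local_form_map)
      ultimately show ?thesis using \<phi> by (simp add: tvec_of_add tvec_of_scaleR)
    qed
    then show ?B by blast
  qed
  then show ?thesis unfolding one_forms_def by auto
qed

lemma one_forms_outside:
  "\<alpha> \<in> one_forms A \<Longrightarrow> \<not> (p \<in> points A \<and> v \<in> tangent_space A p) \<Longrightarrow> \<alpha> p v = 0"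
  by (simp add: one_forms_def)

lemma linear_local_form:
  "\<alpha> \<in> one_forms A \<Longrightarrow> \<phi> \<in> A \<Longrightarrow> x \<in> chart_image \<phi> \<Longrightarrow> linear (local_form A \<alpha> \<phi> x)"
  by (simp add: one_forms_iff)

lemma smooth_local_form:
  "\<alpha> \<in> one_forms A \<Longrightarrow> \<phi> \<in> A \<Longrightarrow> smooth_on (\<lambda>x. local_form A \<alpha> \<phi> x a) (chart_image \<phi>)"
  by (simp add: one_forms_iff)

lemma differentiable_local_form:
  "\<alpha> \<in> one_forms A \<Longrightarrow> \<phi> \<in> A \<Longrightarrow> x \<in> chart_image \<phi> \<Longrightarrow>
    (\<lambda>x. local_form A \<alpha> \<phi> x a) differentiable at x"
  by (rule smooth_on_differentiable[OF smooth_local_form])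

lemma one_form_eqI:
  assumes "\<alpha> \<in> one_forms A" "\<beta> \<in> one_forms A"
    and "\<And>\<phi> x a. \<phi> \<in> A \<Longrightarrow> x \<in> chart_image \<phi> \<Longrightarrow> local_form A \<alpha> \<phi> x a = local_form A \<beta> \<phi> x a"
  shows "\<alpha> = \<beta>"
  by (rule form_eqI[OF one_forms_outside[OF assms(1)] one_forms_outside[OF assms(2)] assms(3)])

end

lemma local_form_add: "local_form A (\<alpha> + \<beta>) \<phi> x a = local_form A \<alpha> \<phi> x a + local_form A \<beta> \<phi> x a"
  by (simp add: local_form_def)

lemma local_form_scaleR: "local_form A (r *\<^sub>R \<alpha>) \<phi> x a = r * local_form A \<alpha> \<phi> x a"
  by (simp add: local_form_def scaleR_fun_def)

lemma local_form_0: "local_form A 0 \<phi> x a = 0"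
  by (simp add: local_form_def)

context smooth_atlas
begin

lemma subspace_one_forms: "subspace (one_forms A)"
proof (rule subspaceI)
  show "0 \<in> one_forms A"
    unfolding one_forms_iff local_form_0
    by (auto simp: local_form_0 linear_iff smooth_on_const)
next
  fix \<alpha> \<beta> assume "\<alpha> \<in> one_forms A" "\<beta> \<in> one_forms A"
  then show "\<alpha> + \<beta> \<in> one_forms A"
    unfolding one_forms_iff local_form_add
    by (auto simp: linear_iff local_form_add algebra_simps intro!: smooth_on_add open_chart_image)
next
  fix r \<alpha> assume "\<alpha> \<in> one_forms A"
  then show "r *\<^sub>R \<alpha> \<in> one_forms A"
    unfolding one_forms_iff local_form_scaleR
    by (auto simp: linear_iff local_form_scaleR scaleR_fun_def algebra_simps
        intro!: smooth_on_bounded_linear_comp[OF _ bounded_linear_mult_right] open_chart_image)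
qed

section \<open>Differentials of functions\<close>

lemma smooth_function_differentiable:
  "f \<in> smooth_functions A \<Longrightarrow> \<phi> \<in> A \<Longrightarrow> x \<in> chart_image \<phi> \<Longrightarrow> (f \<circ> chart_inv \<phi>) differentiable at x"
  by (rule smooth_on_differentiable[of _ "chart_image \<phi>"]) (simp_all add: smooth_functions_def)

text \<open>
  The differential at a point is computed in the chart that \<open>some_chart\<close> picks there, which varies
  with the point; the chain rule transports it to the given chart.
\<close>

lemma local_form_differential:
  assumes f: "f \<in> smooth_functions A" and \<phi>: "\<phi> \<in> A" and x: "x \<in> chart_image \<phi>"
  shows "local_form A (differential A f) \<phi> x a = D (f \<circ> chart_inv \<phi>) x a"
proof -
  define p where "p = chart_inv \<phi> x"
  have p: "p \<in> chart_dom \<phi>" "x = chart_map \<phi> p"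
    using x by (simp_all add: p_def chart_inv_in_dom chart_map_inv)
  have \<phi>p: "\<phi> \<in> charts_at A p" using \<phi> p by (simp add: in_charts_at)
  have pA: "p \<in> points A" using \<phi> p by (auto simp: points_def)
  define \<xi> where "\<xi> = some_chart A p"
  have \<xi>: "\<xi> \<in> charts_at A p" using some_chart_in[OF pA] by (simp add: \<xi>_def)
  have "local_form A (differential A f) \<phi> x a = D (f \<circ> chart_inv \<xi>) (chart_map \<xi> p) (jac \<phi> \<xi> p a)"
    using \<xi> by (simp add: p(2) local_form_map[OF \<phi>p] differential_def pA Let_def
        tvec_of_in_tangent_space[OF \<phi>p] \<xi>_def[symmetric] tvec_of_apply)
  moreover have "(f \<circ> chart_inv \<xi>) differentiable at (chart_map \<xi> p)"
    using smooth_function_differentiable[OF f] \<xi> by (simp add: in_charts_at chart_map_in_image)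
  ultimately show ?thesis
    unfolding p(2) using D_change_chart(1)[OF \<phi>p \<xi>] by metis
qed

lemma differential_in_one_forms:
  assumes f: "f \<in> smooth_functions A"
  shows "differential A f \<in> one_forms A"
  unfolding one_forms_iff
proof (intro conjI ballI allI impI)
  fix \<phi> x assume "\<phi> \<in> A" "x \<in> chart_image \<phi>"
  then show "linear (local_form A (differential A f) \<phi> x)"
    using linear_D[OF smooth_function_differentiable[OF f]] local_form_differential[OF f]
    by (simp add: linear_iff)
next
  fix \<phi> a assume \<phi>: "\<phi> \<in> A"
  have "smooth_on (\<lambda>x. D (f \<circ> chart_inv \<phi>) x a) (chart_image \<phi>)"
    using f \<phi> smooth_on_D unfolding smooth_functions_def by blast
  then show "smooth_on (\<lambda>x. local_form A (differential A f) \<phi> x a) (chart_image \<phi>)"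
    by (subst smooth_on_cong[OF open_chart_image[OF \<phi>]]) (rule local_form_differential[OF f \<phi>])
qed (auto simp: differential_def)

lemma subspace_smooth_functions: "subspace (smooth_functions A)"
proof (rule subspaceI)
  show "0 \<in> smooth_functions A"
    by (auto simp: smooth_functions_def comp_def smooth_on_const)
next
  fix f g assume "f \<in> smooth_functions A" "g \<in> smooth_functions A"
  then show "f + g \<in> smooth_functions A"
    by (auto simp: smooth_functions_def comp_def intro!: smooth_on_add open_chart_image)
next
  fix r f assume "f \<in> smooth_functions A"
  then show "r *\<^sub>R f \<in> smooth_functions A"
    by (auto simp: smooth_functions_def comp_def scaleR_fun_def
        intro!: smooth_on_bounded_linear_comp[OF _ bounded_linear_mult_right] open_chart_image)
qed

lemma differential_add:
  assumes f: "f \<in> smooth_functions A" and g: "g \<in> smooth_functions A"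
  shows "differential A (f + g) = differential A f + differential A g"
proof (rule one_form_eqI)
  have fg: "f + g \<in> smooth_functions A" using f g subspace_smooth_functions subspace_add by blast
  then show "differential A (f + g) \<in> one_forms A" by (rule differential_in_one_forms)
  show "differential A f + differential A g \<in> one_forms A"
    using f g subspace_one_forms subspace_add differential_in_one_forms by blast
  fix \<phi> x a assume "\<phi> \<in> A" "x \<in> chart_image \<phi>"
  then show "local_form A (differential A (f + g)) \<phi> x a
      = local_form A (differential A f + differential A g) \<phi> x a"
    using D_add[OF smooth_function_differentiable[OF f] smooth_function_differentiable[OF g], of \<phi> x \<phi>]
    by (simp add: local_form_add local_form_differential f g fg comp_def)
qed

lemma differential_scaleR:
  assumes f: "f \<in> smooth_functions A"
  shows "differential A (r *\<^sub>R f) = r *\<^sub>R differential A f"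
proof (rule one_form_eqI)
  have rf: "r *\<^sub>R f \<in> smooth_functions A" using f subspace_smooth_functions subspace_scale by blast
  then show "differential A (r *\<^sub>R f) \<in> one_forms A" by (rule differential_in_one_forms)
  show "r *\<^sub>R differential A f \<in> one_forms A"
    using f subspace_one_forms subspace_scale differential_in_one_forms by blast
  fix \<phi> x a assume "\<phi> \<in> A" "x \<in> chart_image \<phi>"
  then show "local_form A (differential A (r *\<^sub>R f)) \<phi> x a
      = local_form A (r *\<^sub>R differential A f) \<phi> x a"
    using D_bounded_linear_comp[OF bounded_linear_mult_right[of r] smooth_function_differentiable[OF f], of \<phi> x]
    by (simp add: local_form_scaleR local_form_differential f rf)
      (simp add: comp_def scaleR_fun_def)
qed

lemma subspace_exact: "subspace (differential A ` smooth_functions A)"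
proof (rule subspaceI)
  have "differential A (0 *\<^sub>R 0) = 0 *\<^sub>R differential A 0"
    using differential_scaleR subspace_0[OF subspace_smooth_functions] by blast
  then have "differential A 0 = 0" by simp
  then show "0 \<in> differential A ` smooth_functions A"
    using subspace_0[OF subspace_smooth_functions] by (metis imageI)
next
  fix \<alpha> \<beta> assume "\<alpha> \<in> differential A ` smooth_functions A" "\<beta> \<in> differential A ` smooth_functions A"
  then obtain f g where fg: "f \<in> smooth_functions A" "g \<in> smooth_functions A"
    and eq: "\<alpha> = differential A f" "\<beta> = differential A g" by blast
  show "\<alpha> + \<beta> \<in> differential A ` smooth_functions A"
    unfolding eq differential_add[OF fg, symmetric]
    by (intro imageI subspace_add[OF subspace_smooth_functions] fg)
next
  fix r \<alpha> assume "\<alpha> \<in> differential A ` smooth_functions A"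
  then obtain f where f: "f \<in> smooth_functions A" and eq: "\<alpha> = differential A f" by blast
  show "r *\<^sub>R \<alpha> \<in> differential A ` smooth_functions A"
    unfolding eq differential_scaleR[OF f, symmetric]
    by (intro imageI subspace_scale[OF subspace_smooth_functions] f)
qed

section \<open>Closed one-forms\<close>

text \<open>
  The components of $d\alpha$ in the chart \<open>\<phi>\<close>.
\<close>

definition curl where
  "curl \<alpha> \<phi> x a b = D (\<lambda>y. local_form A \<alpha> \<phi> y b) x a - D (\<lambda>y. local_form A \<alpha> \<phi> y a) x b"

text \<open>
  Differentiating the transformation rule of \<open>local_form\<close> yields the transformed derivative of
  \<open>\<alpha>\<close> and a term with the second derivative of the transition map. The latter is symmetric in
  \<open>a\<close> and \<open>b\<close>, hence cancels in the antisymmetrisation.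
\<close>

lemma curl_change:
  assumes \<alpha>: "\<alpha> \<in> one_forms A" and \<phi>: "\<phi> \<in> charts_at A p" and \<psi>: "\<psi> \<in> charts_at A p"
  shows "curl \<alpha> \<phi> (chart_map \<phi> p) a b = curl \<alpha> \<psi> (chart_map \<psi> p) (jac \<phi> \<psi> p a) (jac \<phi> \<psi> p b)"
proof -
  have A: "\<phi> \<in> A" "\<psi> \<in> A" "p \<in> chart_dom \<phi>" "p \<in> chart_dom \<psi>"
    using \<phi> \<psi> by (auto simp: in_charts_at)
  let ?G = "local_form A \<alpha> \<psi>" and ?x = "chart_map \<phi> p" and ?z = "chart_map \<psi> p"
    and ?\<tau> = "transition \<phi> \<psi>"
  have x: "?x \<in> overlap \<phi> \<psi>" using A by auto
  have z: "?z \<in> chart_image \<psi>" by (rule chart_map_in_image[OF A(4)])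
  have D: "D (\<lambda>y. local_form A \<alpha> \<phi> y b) ?x a
      = D (\<lambda>z. ?G z (jac \<phi> \<psi> p b)) ?z (jac \<phi> \<psi> p a) + ?G ?z (D (\<lambda>y. D ?\<tau> y b) ?x a)" for a b
  proof -
    have "((\<lambda>y. (?\<tau> y, D ?\<tau> y b)) has_derivative (\<lambda>a. (jac \<phi> \<psi> p a, D (\<lambda>y. D ?\<tau> y b) ?x a))) (at ?x)"
      by (rule has_derivative_Pair[OF transition_has_derivative[OF \<phi> \<psi>] D_has_derivative[OF
            smooth_on_differentiable[OF smooth_on_D[OF smooth_transition[OF A(1,2)]] x]]])
    moreover have "((\<lambda>(z, e). ?G z e) has_derivative
        (\<lambda>(b', c). D (\<lambda>z. ?G z (jac \<phi> \<psi> p b)) ?z b' + ?G ?z c)) (at (?\<tau> ?x, D ?\<tau> ?x b))"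
      unfolding transition_map[OF A(1,3)]
      by (rule linear_family_has_derivative[OF open_chart_image[OF A(2)] z])
        (rule linear_local_form[OF \<alpha> A(2)] differentiable_local_form[OF \<alpha> A(2) z], assumption?)+
    ultimately have "((\<lambda>y. (\<lambda>(z, e). ?G z e) (?\<tau> y, D ?\<tau> y b)) has_derivative
       (\<lambda>a. (\<lambda>(b', c). D (\<lambda>z. ?G z (jac \<phi> \<psi> p b)) ?z b' + ?G ?z c)
          (jac \<phi> \<psi> p a, D (\<lambda>y. D ?\<tau> y b) ?x a))) (at ?x)"
      by (rule has_derivative_compose)
    from D_eqI[OF this] have "D (\<lambda>y. ?G (?\<tau> y) (D ?\<tau> y b)) ?x a
      = D (\<lambda>z. ?G z (jac \<phi> \<psi> p b)) ?z (jac \<phi> \<psi> p a) + ?G ?z (D (\<lambda>y. D ?\<tau> y b) ?x a)"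
      unfolding prod.case by metis
    moreover have "local_form A \<alpha> \<phi> y b = ?G (?\<tau> y) (D ?\<tau> y b)" if "y \<in> overlap \<phi> \<psi>" for y
      using that A local_form_change[of \<phi> _ \<psi>] by (auto simp: transition_map in_charts_at)
    then have "D (\<lambda>y. local_form A \<alpha> \<phi> y b) ?x = D (\<lambda>y. ?G (?\<tau> y) (D ?\<tau> y b)) ?x"
      by (rule D_cong[OF open_overlap[OF A(1,2)] x])
    ultimately show ?thesis by simp
  qed
  have sym: "D (\<lambda>y. D ?\<tau> y b) ?x a = D (\<lambda>y. D ?\<tau> y a) ?x b"
    by (rule symmetric_second_derivative[OF smooth_transition[OF A(1,2)] open_overlap[OF A(1,2)] x])
  show ?thesis unfolding curl_def D[of b a] D[of a b] sym by (rule add_diff_cancel_right)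
qed

text \<open>
  Since \<open>ext_deriv\<close> inspects each point in a single chart, invariance of the curl is what
  makes the closedness equations available in every chart, in particular on a whole neighbourhood.
\<close>

lemma closed_iff_curl:
  assumes \<alpha>: "\<alpha> \<in> one_forms A"
  shows "ext_deriv A \<alpha> = 0 \<longleftrightarrow> (\<forall>\<phi>\<in>A. \<forall>x\<in>chart_image \<phi>. \<forall>a b. curl \<alpha> \<phi> x a b = 0)"
proof -
  have curl: "ext_deriv A \<alpha> p v w
      = curl \<alpha> (some_chart A p) (chart_map (some_chart A p) p) (v (some_chart A p)) (w (some_chart A p))"
    if "p \<in> points A" "v \<in> tangent_space A p" "w \<in> tangent_space A p" for p v w
    using that by (simp add: ext_deriv_def curl_def Let_def)
  show ?thesis
  proof
    assume 0: "ext_deriv A \<alpha> = 0"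
    show "\<forall>\<phi>\<in>A. \<forall>x\<in>chart_image \<phi>. \<forall>a b. curl \<alpha> \<phi> x a b = 0"
      unfolding ball_chart_image
    proof (intro ballI allI)
      fix \<phi> p a b assume \<phi>: "\<phi> \<in> A" "p \<in> chart_dom \<phi>"
      then have \<phi>p: "\<phi> \<in> charts_at A p" and p: "p \<in> points A" by (auto simp: in_charts_at points_def)
      have "ext_deriv A \<alpha> p (tvec_of A \<phi> p a) (tvec_of A \<phi> p b) = 0" using 0 by simp
      then show "curl \<alpha> \<phi> (chart_map \<phi> p) a b = 0"
        using curl[OF p tvec_of_in_tangent_space[OF \<phi>p] tvec_of_in_tangent_space[OF \<phi>p]]
          curl_change[OF \<alpha> \<phi>p some_chart_in[OF p]]
        by (simp add: tvec_of_apply some_chart_in[OF p])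
    qed
  next
    assume R: "\<forall>\<phi>\<in>A. \<forall>x\<in>chart_image \<phi>. \<forall>a b. curl \<alpha> \<phi> x a b = 0"
    show "ext_deriv A \<alpha> = 0"
    proof (intro ext)
      fix p v w
      show "ext_deriv A \<alpha> p v w = 0 p v w"
      proof (cases "p \<in> points A \<and> v \<in> tangent_space A p \<and> w \<in> tangent_space A p")
        case True
        with R curl some_chart_in[of p A] show ?thesis
          by (simp add: in_charts_at chart_map_in_image)
      qed (auto simp: ext_deriv_def)
    qed
  qed
qed

definition closed_forms where
  "closed_forms = {\<beta> \<in> one_forms A. ext_deriv A \<beta> = 0}"

lemma closed_forms_iff:
  "\<alpha> \<in> closed_forms \<longleftrightarrow> \<alpha> \<in> one_forms A \<and>
    (\<forall>\<phi>\<in>A. \<forall>x\<in>chart_image \<phi>. \<forall>a b.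
      D (\<lambda>y. local_form A \<alpha> \<phi> y b) x a = D (\<lambda>y. local_form A \<alpha> \<phi> y a) x b)"
  unfolding closed_forms_def mem_Collect_eq
  by (rule conj_cong[OF refl]) (simp only: closed_iff_curl curl_def right_minus_eq)

lemma closed_formsD:
  assumes "\<alpha> \<in> closed_forms" "\<phi> \<in> A" "x \<in> chart_image \<phi>"
  shows "D (\<lambda>y. local_form A \<alpha> \<phi> y b) x a = D (\<lambda>y. local_form A \<alpha> \<phi> y a) x b"
  using assms(1)[unfolded closed_forms_iff, THEN conjunct2, rule_format, OF assms(2,3)] .

lemma closed_forms_one_forms: "\<alpha> \<in> closed_forms \<Longrightarrow> \<alpha> \<in> one_forms A"
  by (simp add: closed_forms_def)

lemma subspace_closed_forms: "subspace closed_forms"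
proof (rule subspaceI)
  show "0 \<in> closed_forms"
    using subspace_0[OF subspace_one_forms] by (simp add: closed_forms_iff local_form_0)
next
  fix \<alpha> \<beta> assume \<alpha>: "\<alpha> \<in> closed_forms" and \<beta>: "\<beta> \<in> closed_forms"
  note \<alpha>\<beta> = closed_forms_one_forms[OF \<alpha>] closed_forms_one_forms[OF \<beta>]
  show "\<alpha> + \<beta> \<in> closed_forms"
    unfolding closed_forms_iff
  proof (intro conjI ballI allI subspace_add[OF subspace_one_forms] \<alpha>\<beta>)
    fix \<phi> x a b assume x: "\<phi> \<in> A" "x \<in> chart_image \<phi>"
    show "D (\<lambda>y. local_form A (\<alpha> + \<beta>) \<phi> y b) x a = D (\<lambda>y. local_form A (\<alpha> + \<beta>) \<phi> y a) x b"
      unfolding local_form_add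
      by (simp only: D_add differentiable_local_form[OF \<alpha>\<beta>(1) x] differentiable_local_form[OF \<alpha>\<beta>(2) x]
          closed_formsD[OF \<alpha> x, of b a] closed_formsD[OF \<beta> x, of b a])
  qed
next
  fix r \<alpha> assume \<alpha>: "\<alpha> \<in> closed_forms"
  note \<alpha>1 = closed_forms_one_forms[OF \<alpha>]
  show "r *\<^sub>R \<alpha> \<in> closed_forms"
    unfolding closed_forms_iff
  proof (intro conjI ballI allI subspace_scale[OF subspace_one_forms] \<alpha>1)
    fix \<phi> x a b assume x: "\<phi> \<in> A" "x \<in> chart_image \<phi>"
    show "D (\<lambda>y. local_form A (r *\<^sub>R \<alpha>) \<phi> y b) x a = D (\<lambda>y. local_form A (r *\<^sub>R \<alpha>) \<phi> y a) x b"
      unfolding local_form_scaleR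
        D_bounded_linear_comp[OF bounded_linear_mult_right differentiable_local_form[OF \<alpha>1 x]]
      by (simp only: closed_formsD[OF \<alpha> x, of b a])
  qed
qed

lemma differential_closed:
  assumes f: "f \<in> smooth_functions A"
  shows "differential A f \<in> closed_forms"
  unfolding closed_forms_iff
proof (intro conjI ballI allI)
  show "differential A f \<in> one_forms A" using f by (rule differential_in_one_forms)
  fix \<phi> x a b assume \<phi>: "\<phi> \<in> A" and x: "x \<in> chart_image \<phi>"
  have "D (\<lambda>y. local_form A (differential A f) \<phi> y a) x = D (\<lambda>y. D (f \<circ> chart_inv \<phi>) y a) x" for a
    by (rule D_cong[OF open_chart_image[OF \<phi>] x]) (simp add: local_form_differential[OF f \<phi>])
  moreover have "smooth_on (f \<circ> chart_inv \<phi>) (chart_image \<phi>)"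
    using f \<phi> by (simp add: smooth_functions_def)
  ultimately show "D (\<lambda>y. local_form A (differential A f) \<phi> y b) x a
      = D (\<lambda>y. local_form A (differential A f) \<phi> y a) x b"
    using symmetric_second_derivative[OF _ open_chart_image[OF \<phi>] x] by metis
qed

end

section \<open>Pullback along maps that are linear in charts\<close>

text \<open>
  The projection of the tangent bundle is $(x, v) \mapsto x$ and its zero section is
  $x \mapsto (x, 0)$ in suitable charts. For maps that are given by one and the same linear map \<open>L\<close>
  in all charts, pullback is the substitution of \<open>L\<close> in the local form.
\<close>

locale linear_in_charts = M: smooth_atlas A + N: smooth_atlas A'
  for A :: "('a, 'e::finite_dim_inner) chart set" and A' :: "('b, 'f::finite_dim_inner) chart set" +
  fixes F :: "'a \<Rightarrow> 'b" and L :: "'e \<Rightarrow> 'f" and h :: "('a, 'e) chart \<Rightarrow> ('b, 'f) chart"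
  assumes bounded_linear_L: "bounded_linear L"
    and target_chart: "\<phi> \<in> A \<Longrightarrow> h \<phi> \<in> A'"
    and maps_dom: "\<phi> \<in> A \<Longrightarrow> p \<in> chart_dom \<phi> \<Longrightarrow> F p \<in> chart_dom (h \<phi>)"
    and in_charts: "\<phi> \<in> A \<Longrightarrow> p \<in> chart_dom \<phi> \<Longrightarrow> chart_map (h \<phi>) (F p) = L (chart_map \<phi> p)"
begin

lemma L_in_image: "\<phi> \<in> A \<Longrightarrow> x \<in> chart_image \<phi> \<Longrightarrow> L x \<in> chart_image (h \<phi>)"
  using in_charts[OF _ chart_inv_in_dom] maps_dom[OF _ chart_inv_in_dom]
  by (metis chart_map_in_image chart_map_inv)

lemma target_in_charts_at: "\<phi> \<in> charts_at A p \<Longrightarrow> h \<phi> \<in> charts_at A' (F p)"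
  by (simp add: in_charts_at target_chart maps_dom)

text \<open>
  The source chart in \<open>tangent_map\<close> is the one that \<open>some_chart\<close> picks at \<open>p\<close>, and every target
  chart \<open>\<psi>\<close> around \<open>F p\<close> has to be considered. From \<open>\<phi>\<close> to \<open>\<psi>\<close>, the map \<open>F\<close> is
  represented by \<open>transition (h \<phi>) \<psi> \<circ> L\<close>, but only where \<open>L\<close> maps into the overlap of
  \<open>h \<phi>\<close> and \<open>\<psi>\<close>.
\<close>

lemma tangent_map_tvec_of:
  assumes \<phi>: "\<phi> \<in> charts_at A p"
  shows "tangent_map A A' F p (tvec_of A \<phi> p a) = tvec_of A' (h \<phi>) (F p) (L a)"
proof
  fix \<psi>
  define \<xi> where "\<xi> = some_chart A p"
  have "p \<in> points A" using \<phi> by (auto simp: in_charts_at points_def)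
  then have \<xi>: "\<xi> \<in> charts_at A p" unfolding \<xi>_def by (rule some_chart_in)
  have A: "\<phi> \<in> A" "p \<in> chart_dom \<phi>" "\<xi> \<in> A" "p \<in> chart_dom \<xi>"
    using \<phi> \<xi> by (auto simp: in_charts_at)
  note hL = target_in_charts_at[OF \<xi>] target_in_charts_at[OF \<phi>]
  show "tangent_map A A' F p (tvec_of A \<phi> p a) \<psi> = tvec_of A' (h \<phi>) (F p) (L a) \<psi>"
  proof (cases "\<psi> \<in> charts_at A' (F p)")
    case True
    let ?U = "chart_image \<phi> \<inter> L -` overlap (h \<phi>) \<psi>"
    have \<psi>A: "\<psi> \<in> A'" "h \<phi> \<in> A'" using True hL by (auto simp: in_charts_at)
    have U: "open ?U"
      using M.open_chart_image[OF A(1)] N.open_overlap[OF \<psi>A(2,1)] bounded_linear_L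
      by (intro open_Int open_vimage) (simp_all add: linear_continuous_on)
    have pU: "chart_map \<phi> p \<in> ?U"
      using A True in_charts[OF A(1,2)] maps_dom[OF A(1,2)]
      by (auto simp: in_charts_at chart_map_in_image intro!: image_eqI[of _ _ "F p"])
    have eq: "transition (h \<phi>) \<psi> (L x) = (chart_map \<psi> \<circ> F \<circ> chart_inv \<phi>) x" if "x \<in> ?U" for x
    proof -
      have x: "chart_inv \<phi> x \<in> chart_dom \<phi>" "chart_map \<phi> (chart_inv \<phi> x) = x"
        using that by (simp_all add: chart_inv_in_dom chart_map_inv)
      show ?thesis
        using N.transition_map[OF \<psi>A(2) maps_dom[OF A(1) x(1)]] in_charts[OF A(1) x(1)]
        by (simp add: x(2))
    qed
    have Lp: "L (chart_map \<phi> p) = chart_map (h \<phi>) (F p)" using in_charts A by simp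
    have "((\<lambda>x. transition (h \<phi>) \<psi> (L x)) has_derivative (\<lambda>a. jac (h \<phi>) \<psi> (F p) (L a)))
        (at (chart_map \<phi> p))"
      using has_derivative_compose[OF bounded_linear_imp_has_derivative[OF bounded_linear_L]]
        N.transition_has_derivative[OF hL(2) True] Lp by metis
    then have der: "((chart_map \<psi> \<circ> F \<circ> chart_inv \<phi>) has_derivative (\<lambda>a. jac (h \<phi>) \<psi> (F p) (L a)))
        (at (chart_map \<phi> p))"
      by (rule has_derivative_transform_within_open[OF _ U pU eq])
    then have diff: "(chart_map \<psi> \<circ> F \<circ> chart_inv \<phi>) differentiable at (chart_map \<phi> p)"
      by (auto simp: differentiable_def)
    have diff': "(chart_map \<psi> \<circ> F \<circ> chart_inv \<xi>) differentiable at (chart_map \<xi> p)"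
      by (rule M.D_change_chart(2)[OF \<xi> \<phi>]) (rule diff)
    have "tangent_map A A' F p (tvec_of A \<phi> p a) \<psi>
        = D (chart_map \<psi> \<circ> F \<circ> chart_inv \<xi>) (chart_map \<xi> p) (jac \<phi> \<xi> p a)"
      using True \<xi> by (simp add: tangent_map_def Let_def \<xi>_def[symmetric] M.tvec_of_apply)
    also have "\<dots> = D (chart_map \<psi> \<circ> F \<circ> chart_inv \<phi>) (chart_map \<phi> p) a"
      using M.D_change_chart(1)[OF \<phi> \<xi> diff'] by simp
    also have "\<dots> = jac (h \<phi>) \<psi> (F p) (L a)" using D_eqI[OF der] by simp
    finally show ?thesis using True by (simp add: N.tvec_of_apply)
  qed (simp_all add: tangent_map_def tvec_of_def Let_def)
qed

lemma local_form_pullback: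
  assumes \<phi>: "\<phi> \<in> A" and x: "x \<in> chart_image \<phi>"
  shows "local_form A (pullback A A' F \<mu>) \<phi> x a = local_form A' \<mu> (h \<phi>) (L x) (L a)"
proof -
  define p where "p = chart_inv \<phi> x"
  have p: "p \<in> chart_dom \<phi>" "x = chart_map \<phi> p"
    using x by (simp_all add: p_def chart_inv_in_dom chart_map_inv)
  then have \<phi>p: "\<phi> \<in> charts_at A p" and "p \<in> points A"
    using \<phi> by (auto simp: in_charts_at points_def)
  then show ?thesis
    using N.local_form_map[OF target_in_charts_at[OF \<phi>p]] in_charts[OF \<phi> p(1)]
    by (simp add: p(2) M.local_form_map[OF \<phi>p] pullback_def tangent_map_tvec_of M.tvec_of_in_tangent_space)
qed

lemma pullback_in_one_forms:
  assumes \<mu>: "\<mu> \<in> one_forms A'"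
  shows "pullback A A' F \<mu> \<in> one_forms A"
  unfolding M.one_forms_iff
proof (intro conjI ballI allI impI)
  fix \<phi> x assume "\<phi> \<in> A" "x \<in> chart_image \<phi>"
  then have "linear (local_form A' \<mu> (h \<phi>) (L x))"
    using N.linear_local_form[OF \<mu>] target_chart L_in_image by blast
  from linear_compose[OF bounded_linear.linear[OF bounded_linear_L] this]
  show "linear (local_form A (pullback A A' F \<mu>) \<phi> x)"
    using local_form_pullback \<open>\<phi> \<in> A\<close> \<open>x \<in> chart_image \<phi>\<close> by (simp add: comp_def linear_iff)
next
  fix \<phi> a assume \<phi>: "\<phi> \<in> A"
  have "smooth_on (\<lambda>x. local_form A' \<mu> (h \<phi>) (L x) (L a)) (L -` chart_image (h \<phi>))"
    using smooth_on_comp_bounded_linear[OF N.open_chart_image bounded_linear_L N.smooth_local_form]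
      \<mu> target_chart[OF \<phi>] by blast
  then have "smooth_on (\<lambda>x. local_form A' \<mu> (h \<phi>) (L x) (L a)) (chart_image \<phi>)"
    using L_in_image[OF \<phi>] by (auto elim: smooth_on_subset)
  then show "smooth_on (\<lambda>x. local_form A (pullback A A' F \<mu>) \<phi> x a) (chart_image \<phi>)"
    by (subst smooth_on_cong[OF M.open_chart_image[OF \<phi>]]) (rule local_form_pullback[OF \<phi>])
qed (auto simp: pullback_def)

lemma pullback_closed:
  assumes \<mu>: "\<mu> \<in> N.closed_forms"
  shows "pullback A A' F \<mu> \<in> M.closed_forms"
  unfolding M.closed_forms_iff
proof (intro conjI ballI allI)
  have \<mu>1: "\<mu> \<in> one_forms A'" using \<mu> by (rule N.closed_forms_one_forms)
  then show "pullback A A' F \<mu> \<in> one_forms A" by (rule pullback_in_one_forms)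
  fix \<phi> x a b assume \<phi>: "\<phi> \<in> A" and x: "x \<in> chart_image \<phi>"
  have D: "D (\<lambda>y. local_form A (pullback A A' F \<mu>) \<phi> y b) x a
      = D (\<lambda>z. local_form A' \<mu> (h \<phi>) z (L b)) (L x) (L a)" for a b
  proof -
    have "D (\<lambda>y. local_form A (pullback A A' F \<mu>) \<phi> y b) x
        = D (\<lambda>y. local_form A' \<mu> (h \<phi>) (L y) (L b)) x"
      by (rule D_cong[OF M.open_chart_image[OF \<phi>] x]) (simp add: local_form_pullback[OF \<phi>])
    then show ?thesis
      using D_comp_bounded_linear[OF bounded_linear_L
          N.differentiable_local_form[OF \<mu>1 target_chart[OF \<phi>] L_in_image[OF \<phi> x]]] by metis
  qed
  show "D (\<lambda>y. local_form A (pullback A A' F \<mu>) \<phi> y b) x a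
      = D (\<lambda>y. local_form A (pullback A A' F \<mu>) \<phi> y a) x b"
    unfolding D[of a b] D[of b a]
    by (rule N.closed_formsD[OF \<mu> target_chart[OF \<phi>] L_in_image[OF \<phi> x]])
qed

lemma pullback_add: "pullback A A' F (\<mu> + \<nu>) = pullback A A' F \<mu> + pullback A A' F \<nu>"
  by (auto simp: pullback_def fun_eq_iff)

lemma pullback_scaleR: "pullback A A' F (r *\<^sub>R \<mu>) = r *\<^sub>R pullback A A' F \<mu>"
  by (auto simp: pullback_def fun_eq_iff scaleR_fun_def)

end

section \<open>Isomorphic quotient spaces\<close>

lemma coset_eq_iff:
  assumes W: "subspace W"
  shows "x +o W = y +o W \<longleftrightarrow> x - y \<in> W"
proof
  assume "x +o W = y +o W"
  moreover have "x \<in> x +o W" using subspace_0[OF W] set_zero_plus2 by (auto simp: elt_set_plus_def)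
  ultimately obtain w where "w \<in> W" "x = y + w" by (auto simp: elt_set_plus_def)
  then show "x - y \<in> W" by simp
next
  assume xy: "x - y \<in> W"
  have "x + w = y + ((x - y) + w) \<and> y + w = x + (w - (x - y))" for w by simp
  then show "x +o W = y +o W"
    unfolding elt_set_plus_def
    using xy subspace_add[OF W xy] subspace_diff[OF W _ xy] by blast
qed

lemma coset_add:
  assumes W: "subspace W"
  shows "(x +o W) + (y +o W) = (x + y) +o W"
proof -
  have "W + W = W"
    using subspace_add[OF W] subspace_0[OF W] by (force simp: set_plus_def)
  then show ?thesis by (simp add: set_plus_rearrange)
qed

lemma coset_scale:
  assumes W: "subspace W"
  shows "(\<lambda>z. r *\<^sub>R z) ` (x +o W) + W = (r *\<^sub>R x) +o W"
proof (intro set_eqI iffI)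
  fix z assume "z \<in> (\<lambda>z. r *\<^sub>R z) ` (x +o W) + W"
  then obtain w w' where "w \<in> W" "w' \<in> W" "z = r *\<^sub>R x + (r *\<^sub>R w + w')"
    by (auto simp: set_plus_def elt_set_plus_def scaleR_add_right add.assoc)
  then show "z \<in> (r *\<^sub>R x) +o W"
    using subspace_add[OF W] subspace_scale[OF W] by (auto simp: elt_set_plus_def)
next
  fix z assume "z \<in> (r *\<^sub>R x) +o W"
  then obtain w where "w \<in> W" "z = r *\<^sub>R (x + 0) + w" by (auto simp: elt_set_plus_def)
  then show "z \<in> (\<lambda>z. r *\<^sub>R z) ` (x +o W) + W"
    using subspace_0[OF W] unfolding set_plus_def elt_set_plus_def by blast
qed

text \<open>
  First isomorphism theorem, in the form that \<open>P\<close> induces a bijection between the cosets of \<open>E\<close>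
  and those of \<open>B\<close> by taking images.
\<close>

lemma quotient_vs_isomorphic:
  fixes P :: "'v::real_vector \<Rightarrow> 'w::real_vector"
  assumes P: "linear P" and V: "subspace V" and B: "subspace B"
    and PV: "P ` V = C" and BC: "B \<subseteq> C" and E: "E = {x \<in> V. P x \<in> B}"
  shows "subspace E" and "vs_isomorphic (quotient_vs V E) (quotient_vs C B)"
proof -
  have "E = V \<inter> P -` B" using E by auto
  then show sE: "subspace E" using subspace_inter[OF V linear_subspace_vimage[OF P B]] by simp
  have coset: "P ` (x +o E) = P x +o B" if x: "x \<in> V" for x
  proof (intro set_eqI iffI)
    fix z assume "z \<in> P ` (x +o E)"
    then show "z \<in> P x +o B" using E by (auto simp: elt_set_plus_def linear_add[OF P])
  next
    fix z assume "z \<in> P x +o B"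
    then obtain b where b: "b \<in> B" "z = P x + b" by (auto simp: elt_set_plus_def)
    then obtain e where "e \<in> V" "b = P e" using BC PV by blast
    then have "e \<in> E" "z = P (x + e)" using b E by (simp_all add: linear_add[OF P])
    then show "z \<in> P ` (x +o E)" by (auto simp: elt_set_plus_def)
  qed
  have inj: "x +o E = y +o E" if "x \<in> V" "y \<in> V" "P ` (x +o E) = P ` (y +o E)" for x y
  proof -
    have "P (x - y) \<in> B"
      using that(3) unfolding coset[OF that(1)] coset[OF that(2)] coset_eq_iff[OF B] linear_diff[OF P] .
    then show ?thesis
      unfolding coset_eq_iff[OF sE] using E subspace_diff[OF V that(1,2)] by blast
  qed
  have "bij_betw (\<lambda>S. P ` S) ((\<lambda>x. x +o E) ` V) ((\<lambda>x. x +o B) ` C)"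
    unfolding bij_betw_def
  proof
    show "inj_on (\<lambda>S. P ` S) ((\<lambda>x. x +o E) ` V)"
      using inj unfolding inj_on_def by blast
    show "(\<lambda>S. P ` S) ` (\<lambda>x. x +o E) ` V = (\<lambda>x. x +o B) ` C"
      unfolding PV[symmetric] image_image using coset by (rule image_cong[OF refl])
  qed
  moreover have "P ` ((x +o E) + (y +o E)) = P ` (x +o E) + P ` (y +o E)" if "x \<in> V" "y \<in> V" for x y
    using that subspace_add[OF V, of x y] by (simp add: coset_add sE B coset linear_add[OF P])
  moreover have "P ` ((\<lambda>z. r *\<^sub>R z) ` (x +o E) + E) = (\<lambda>z. r *\<^sub>R z) ` (P ` (x +o E)) + B" if "x \<in> V" for r x
    using that subspace_scale[OF V, of x r] by (simp only: coset_scale[OF sE] coset_scale[OF B] coset linear_cmul[OF P])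
  ultimately show "vs_isomorphic (quotient_vs V E) (quotient_vs C B)"
    unfolding vs_isomorphic_def quotient_vs_def by (intro exI[of _ "\<lambda>S. P ` S"]) auto
qed

section \<open>The atlas of the tangent bundle\<close>

lemma dom_induced_chart: "chart_dom (induced_chart A \<phi>) = Sigma (chart_dom \<phi>) (tangent_space A)"
  by (simp add: induced_chart_def)

lemma map_induced_chart: "chart_map (induced_chart A \<phi>) (p, v) = (chart_map \<phi> p, v \<phi>)"
  by (simp add: induced_chart_def)

context smooth_atlas
begin

lemma induced_overlap:
  assumes \<phi>: "\<phi> \<in> A"
  shows "overlap (induced_chart A \<phi>) (induced_chart A \<psi>) = overlap \<phi> \<psi> \<times> UNIV"
proof (intro set_eqI iffI)
  fix y assume "y \<in> overlap (induced_chart A \<phi>) (induced_chart A \<psi>)"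
  then show "y \<in> overlap \<phi> \<psi> \<times> UNIV"
    by (auto simp: dom_induced_chart map_induced_chart)
next
  fix y assume "y \<in> overlap \<phi> \<psi> \<times> (UNIV :: 'e set)"
  then obtain p a where p: "p \<in> chart_dom \<phi>" "p \<in> chart_dom \<psi>" and y: "y = (chart_map \<phi> p, a)"
    by (auto simp: mem_Times_iff prod_eq_iff)
  have \<phi>p: "\<phi> \<in> charts_at A p" using \<phi> p by (simp add: in_charts_at)
  show "y \<in> overlap (induced_chart A \<phi>) (induced_chart A \<psi>)"
    using p tvec_of_in_tangent_space[OF \<phi>p, of a]
    by (intro image_eqI[of _ _ "(p, tvec_of A \<phi> p a)"])
      (simp_all add: y dom_induced_chart map_induced_chart tvec_of_apply_self[OF \<phi>p])
qed

lemma induced_image: "\<phi> \<in> A \<Longrightarrow> chart_image (induced_chart A \<phi>) = chart_image \<phi> \<times> UNIV"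
  using induced_overlap[of \<phi> \<phi>] by (simp add: chart_image_def)

lemma inj_induced:
  assumes \<phi>: "\<phi> \<in> A"
  shows "inj_on (chart_map (induced_chart A \<phi>)) (chart_dom (induced_chart A \<phi>))"
proof (rule inj_onI)
  fix u w
  assume u: "u \<in> chart_dom (induced_chart A \<phi>)" and w: "w \<in> chart_dom (induced_chart A \<phi>)"
    and eq: "chart_map (induced_chart A \<phi>) u = chart_map (induced_chart A \<phi>) w"
  obtain p v q v' where uw: "u = (p, v)" "w = (q, v')" by (metis surj_pair)
  have pq: "p \<in> chart_dom \<phi>" "v \<in> tangent_space A p" "q \<in> chart_dom \<phi>" "v' \<in> tangent_space A q"
    using u w by (simp_all add: uw dom_induced_chart)
  have e: "chart_map \<phi> p = chart_map \<phi> q" "v \<phi> = v' \<phi>"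
    using eq by (simp_all add: uw map_induced_chart)
  then have "p = q" using inj_onD[OF inj_chart[OF \<phi>] _ pq(1,3)] by simp
  moreover have "v = v'"
    using tvec_of_components[of \<phi> p v] tvec_of_components[of \<phi> q v'] \<phi> pq e \<open>p = q\<close>
    by (metis in_charts_at)
  ultimately show "u = w" by (simp add: uw)
qed

text \<open>
  This makes the transition maps of \<open>TM\<close>, and the functions \<open>f_form \<nu> c\<close> in an induced chart,
  explicit functions of \<open>(x, a)\<close>.
\<close>

lemma induced_inv:
  assumes \<phi>: "\<phi> \<in> A" and x: "x \<in> chart_image \<phi>"
  shows "chart_inv (induced_chart A \<phi>) (x, a) = (chart_inv \<phi> x, tvec_of A \<phi> (chart_inv \<phi> x) a)"
proof -
  let ?p = "chart_inv \<phi> x"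
  have \<phi>p: "\<phi> \<in> charts_at A ?p" using \<phi> chart_inv_in_dom[OF x] by (simp add: in_charts_at)
  have "chart_map (induced_chart A \<phi>) (?p, tvec_of A \<phi> ?p a) = (x, a)"
    by (simp add: map_induced_chart chart_map_inv[OF x] tvec_of_apply_self[OF \<phi>p])
  moreover have "(?p, tvec_of A \<phi> ?p a) \<in> chart_dom (induced_chart A \<phi>)"
    by (simp add: dom_induced_chart chart_inv_in_dom[OF x] tvec_of_in_tangent_space[OF \<phi>p])
  ultimately show ?thesis
    unfolding chart_inv_def[of "induced_chart A \<phi>"] by (intro inv_into_f_eq[OF inj_induced[OF \<phi>]])
qed

lemma induced_transition:
  assumes \<phi>: "\<phi> \<in> A" and \<psi>: "\<psi> \<in> A" and x: "x \<in> overlap \<phi> \<psi>"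
  shows "transition (induced_chart A \<phi>) (induced_chart A \<psi>) (x, a)
    = (transition \<phi> \<psi> x, D (transition \<phi> \<psi>) x a)"
proof -
  obtain p where p: "p \<in> chart_dom \<phi>" "p \<in> chart_dom \<psi>" and x: "x = chart_map \<phi> p"
    using x by blast
  have \<psi>p: "\<psi> \<in> charts_at A p" using \<psi> p by (simp add: in_charts_at)
  have "transition (induced_chart A \<phi>) (induced_chart A \<psi>) (x, a)
      = chart_map (induced_chart A \<psi>) (chart_inv (induced_chart A \<phi>) (x, a))"
    by (simp add: transition_def)
  also have "\<dots> = (chart_map \<psi> p, tvec_of A \<phi> p a \<psi>)"
    unfolding x induced_inv[OF \<phi> chart_map_in_image[OF p(1)]] chart_inv_map[OF \<phi> p(1)] map_induced_chart ..
  finally show ?thesis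
    by (simp add: x transition_map[OF \<phi> p(1)] tvec_of_apply[OF \<psi>p])
qed

lemma linear_D_transition:
  assumes "\<phi> \<in> A" "\<psi> \<in> A" "x \<in> overlap \<phi> \<psi>"
  shows "linear (D (transition \<phi> \<psi>) x)"
  by (rule linear_D[OF smooth_on_differentiable[OF smooth_transition[OF assms(1,2)] assms(3)]])

text \<open>
  An induced transition is $(x, a) \mapsto (\tau(x), D\tau(x)\,a)$, whose second component is a
  family of linear maps that depends smoothly on \<open>x\<close>.
\<close>

lemma tangent_atlas_smooth: "smooth_atlas (tangent_atlas A)"
proof
  fix \<Phi> assume "\<Phi> \<in> tangent_atlas A"
  then obtain \<phi> where \<phi>: "\<phi> \<in> A" and \<Phi>: "\<Phi> = induced_chart A \<phi>" by (auto simp: tangent_atlas_def)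
  show "inj_on (chart_map \<Phi>) (chart_dom \<Phi>)" unfolding \<Phi> by (rule inj_induced[OF \<phi>])
  fix \<Psi> assume "\<Psi> \<in> tangent_atlas A"
  then obtain \<psi> where \<psi>: "\<psi> \<in> A" and \<Psi>: "\<Psi> = induced_chart A \<psi>" by (auto simp: tangent_atlas_def)
  note op = open_overlap[OF \<phi> \<psi>] and sm = smooth_transition[OF \<phi> \<psi>]
  show op': "open (overlap \<Phi> \<Psi>)"
    unfolding \<Phi> \<Psi> induced_overlap[OF \<phi>] using op by (simp add: open_Times)
  have "smooth_on (\<lambda>y. (transition \<phi> \<psi> (fst y), (\<lambda>(x, a). D (transition \<phi> \<psi>) x a) y))
      (overlap \<phi> \<psi> \<times> UNIV)"
    by (intro smooth_on_Pair smooth_on_fst linear_family_smooth_on linear_D_transition[OF \<phi> \<psi>]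
        smooth_on_D sm op open_Times open_UNIV)
  then show "smooth_on (transition \<Phi> \<Psi>) (overlap \<Phi> \<Psi>)"
    unfolding \<Phi> \<Psi> induced_overlap[OF \<phi>]
    by (subst smooth_on_cong[OF op'[unfolded \<Phi> \<Psi> induced_overlap[OF \<phi>]]])
      (auto simp: induced_transition[OF \<phi> \<psi>] mem_Times_iff)
qed

text \<open>
  The derivative of an induced transition is block triangular, with the derivative of the transition
  of \<open>M\<close> in both diagonal blocks. This is the reason why the mirror map does not depend on the chart.
\<close>

lemma jac_induced:
  assumes \<phi>: "\<phi> \<in> charts_at A p" and \<psi>: "\<psi> \<in> charts_at A p"
  shows "jac (induced_chart A \<phi>) (induced_chart A \<psi>) (p, v) (b, c)
    = (jac \<phi> \<psi> p b, D (\<lambda>x. D (transition \<phi> \<psi>) x (v \<phi>)) (chart_map \<phi> p) b + jac \<phi> \<psi> p c)"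
proof -
  have A: "\<phi> \<in> A" "\<psi> \<in> A" "p \<in> chart_dom \<phi>" "p \<in> chart_dom \<psi>"
    using \<phi> \<psi> by (auto simp: in_charts_at)
  note op = open_overlap[OF A(1,2)] and sm = smooth_transition[OF A(1,2)]
  let ?\<tau> = "transition \<phi> \<psi>" and ?x = "chart_map \<phi> p"
  have x: "?x \<in> overlap \<phi> \<psi>" using A by auto
  have 1: "((\<lambda>y. ?\<tau> (fst y)) has_derivative (\<lambda>y. jac \<phi> \<psi> p (fst y))) (at (?x, v \<phi>))"
    using has_derivative_compose[OF bounded_linear_imp_has_derivative[OF bounded_linear_fst],
        of ?\<tau> _ "(?x, v \<phi>)"] transition_has_derivative[OF \<phi> \<psi>] by simp
  have 2: "((\<lambda>(x, a). D ?\<tau> x a) has_derivative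
      (\<lambda>(b, c). D (\<lambda>x. D ?\<tau> x (v \<phi>)) ?x b + D ?\<tau> ?x c)) (at (?x, v \<phi>))"
    by (rule linear_family_has_derivative[OF op x linear_D_transition[OF A(1,2)]])
      (assumption, rule smooth_on_differentiable[OF smooth_on_D[OF sm] x])
  have "(transition (induced_chart A \<phi>) (induced_chart A \<psi>) has_derivative
      (\<lambda>y. (jac \<phi> \<psi> p (fst y), (\<lambda>(b, c). D (\<lambda>x. D ?\<tau> x (v \<phi>)) ?x b + D ?\<tau> ?x c) y))) (at (?x, v \<phi>))"
  proof (rule has_derivative_transform_within_open[OF has_derivative_Pair[OF 1 2]])
    show "open (overlap \<phi> \<psi> \<times> (UNIV :: 'e set))" using op by (simp add: open_Times)
    show "(?x, v \<phi>) \<in> overlap \<phi> \<psi> \<times> UNIV" using x by blast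
  qed (auto simp: induced_transition[OF A(1,2)] mem_Times_iff)
  from D_eqI[OF this] show ?thesis by (simp add: map_induced_chart)
qed

text \<open>
  The chart of \<open>M\<close> below an induced chart can thus be recovered from it, which lets the projection
  assign to each chart of \<open>TM\<close> a chart of \<open>M\<close>.
\<close>

lemma inj_on_induced_chart: "inj_on (induced_chart A) A"
proof (rule inj_onI)
  fix \<phi> \<psi> assume A: "\<phi> \<in> A" "\<psi> \<in> A" and eq: "induced_chart A \<phi> = induced_chart A \<psi>"
  have "chart_dom \<phi> = fst ` chart_dom (induced_chart A \<phi>)" if "\<phi> \<in> A" for \<phi>
  proof -
    have "0 \<in> tangent_space A p" if "p \<in> chart_dom \<phi>" for p
      using zero_in_tangent_space[of p] \<open>\<phi> \<in> A\<close> that by (auto simp: points_def)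
    then show ?thesis unfolding dom_induced_chart fst_image_Sigma by blast
  qed
  then have "chart_dom \<phi> = chart_dom \<psi>" using A eq by simp
  moreover have "chart_map \<phi> p = chart_map \<psi> p" for p
    using fun_cong[OF arg_cong[OF eq, of chart_map], of "(p, 0)"] by (simp add: map_induced_chart)
  ultimately show "\<phi> = \<psi>" by (simp add: prod_eq_iff fun_eq_iff)
qed

abbreviation TA where "TA \<equiv> tangent_atlas A"

lemma induced_in: "\<phi> \<in> A \<Longrightarrow> induced_chart A \<phi> \<in> TA"
  by (simp add: tangent_atlas_def)

lemma projection_in_charts:
  "linear_in_charts TA A fst fst (inv_into A (induced_chart A))"
proof -
  show ?thesis
  proof (intro linear_in_charts.intro linear_in_charts_axioms.intro tangent_atlas_smooth smooth_atlas_axioms)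
    show "bounded_linear (fst :: 'e \<times> 'e \<Rightarrow> 'e)" by (rule bounded_linear_fst)
    fix \<Phi> assume "\<Phi> \<in> TA"
    then obtain \<phi> where \<phi>: "\<phi> \<in> A" and \<Phi>: "\<Phi> = induced_chart A \<phi>" by (auto simp: tangent_atlas_def)
    have i: "inv_into A (induced_chart A) \<Phi> = \<phi>"
      unfolding \<Phi> by (rule inv_into_f_f[OF inj_on_induced_chart \<phi>])
    show "inv_into A (induced_chart A) \<Phi> \<in> A" by (simp add: i \<phi>)
    fix u assume u: "u \<in> chart_dom \<Phi>"
    show "fst u \<in> chart_dom (inv_into A (induced_chart A) \<Phi>)"
      using u unfolding i unfolding \<Phi> dom_induced_chart by auto
    show "chart_map (inv_into A (induced_chart A) \<Phi>) (fst u) = fst (chart_map \<Phi> u)"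
      unfolding i unfolding \<Phi> by (cases u) (simp add: map_induced_chart)
  qed
qed

lemma zero_section_in_charts:
  "linear_in_charts A TA (\<lambda>p. (p, 0)) (\<lambda>x. (x, 0)) (induced_chart A)"
proof -
  show ?thesis
  proof (intro linear_in_charts.intro linear_in_charts_axioms.intro tangent_atlas_smooth smooth_atlas_axioms)
    show "bounded_linear (\<lambda>x::'e. (x, 0::'e))"
      by (intro bounded_linear_Pair bounded_linear_ident bounded_linear_zero)
    fix \<phi> p assume \<phi>: "\<phi> \<in> A" and p: "p \<in> chart_dom \<phi>"
    then have "p \<in> points A" by (auto simp: points_def)
    then show "(p, 0) \<in> chart_dom (induced_chart A \<phi>)"
      using p zero_in_tangent_space[of p] by (simp add: dom_induced_chart)
    show "chart_map (induced_chart A \<phi>) (p, 0) = (chart_map \<phi> p, 0)"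
      by (simp add: map_induced_chart)
  qed (rule induced_in)
qed

abbreviation lift where "lift \<equiv> pullback TA A fst"
abbreviation at_zero_section where "at_zero_section \<equiv> pullback A TA (\<lambda>p. (p, 0))"

lemma local_form_lift:
  assumes \<phi>: "\<phi> \<in> A" and x: "x \<in> chart_image \<phi>"
  shows "local_form TA (lift \<beta>) (induced_chart A \<phi>) (x, a) (b, c) = local_form A \<beta> \<phi> x b"
proof -
  interpret linear_in_charts TA A fst fst "inv_into A (induced_chart A)" by (rule projection_in_charts)
  show ?thesis
    using local_form_pullback[OF induced_in[OF \<phi>], of "(x, a)" \<beta> "(b, c)"] x
    by (simp add: induced_image[OF \<phi>] inv_into_f_f[OF inj_on_induced_chart \<phi>])
qed

lemma local_form_zero_section:
  assumes \<phi>: "\<phi> \<in> A" and x: "x \<in> chart_image \<phi>"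
  shows "local_form A (at_zero_section \<alpha>) \<phi> x b = local_form TA \<alpha> (induced_chart A \<phi>) (x, 0) (b, 0)"
  using linear_in_charts.local_form_pullback[OF zero_section_in_charts \<phi> x] .

lemma form_eqI_TA:
  assumes "\<And>u Y. \<not> (u \<in> points TA \<and> Y \<in> tangent_space TA u) \<Longrightarrow> \<alpha> u Y = 0"
    and "\<And>u Y. \<not> (u \<in> points TA \<and> Y \<in> tangent_space TA u) \<Longrightarrow> \<beta> u Y = 0"
    and "\<And>\<phi> x a b c. \<phi> \<in> A \<Longrightarrow> x \<in> chart_image \<phi> \<Longrightarrow>
      local_form TA \<alpha> (induced_chart A \<phi>) (x, a) (b, c) = local_form TA \<beta> (induced_chart A \<phi>) (x, a) (b, c)"
  shows "\<alpha> = \<beta>"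
proof (rule smooth_atlas.form_eqI[OF tangent_atlas_smooth])
  fix \<Phi> y Y assume "\<Phi> \<in> TA" and y: "y \<in> chart_image \<Phi>"
  then obtain \<phi> where \<phi>: "\<phi> \<in> A" and \<Phi>: "\<Phi> = induced_chart A \<phi>" by (auto simp: tangent_atlas_def)
  obtain x a b c :: 'e where eq: "y = (x, a)" "Y = (b, c)" by (metis surj_pair)
  have "x \<in> chart_image \<phi>" using y by (simp add: \<Phi> induced_image[OF \<phi>] eq)
  then show "local_form TA \<alpha> \<Phi> y Y = local_form TA \<beta> \<Phi> y Y"
    unfolding \<Phi> eq by (rule assms(3)[OF \<phi>])
qed (rule assms(1,2), assumption)+

section \<open>The mirror map in induced charts\<close>

lemma mirror_tvec_of:
  assumes \<phi>: "\<phi> \<in> A" and u: "induced_chart A \<phi> \<in> charts_at TA u"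
  shows "mirror A u (tvec_of TA (induced_chart A \<phi>) u (b, c)) = tvec_of TA (induced_chart A \<phi>) u (0, b)"
proof
  fix \<Psi>
  interpret T: smooth_atlas TA by (rule tangent_atlas_smooth)
  show "mirror A u (tvec_of TA (induced_chart A \<phi>) u (b, c)) \<Psi> = tvec_of TA (induced_chart A \<phi>) u (0, b) \<Psi>"
  proof (cases "\<Psi> \<in> charts_at TA u")
    case True
    obtain p v where uv: "u = (p, v)" by (metis surj_pair)
    obtain \<psi> where \<psi>: "\<psi> \<in> A" and \<Psi>: "\<Psi> = induced_chart A \<psi>"
      using True by (auto simp: in_charts_at tangent_atlas_def)
    have p: "\<phi> \<in> charts_at A p" "\<psi> \<in> charts_at A p"
      using \<phi> \<psi> u True by (auto simp: in_charts_at uv \<Psi> dom_induced_chart)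
    have x: "chart_map \<phi> p \<in> overlap \<phi> \<psi>" using p by (auto simp: in_charts_at)
    have 0: "jac \<phi> \<psi> p 0 = 0" using linear_0[OF linear_jac[OF p]] .
    have 1: "D (\<lambda>x. D (transition \<phi> \<psi>) x (v \<phi>)) (chart_map \<phi> p) 0 = 0"
      by (rule linear_0[OF linear_D[OF smooth_on_differentiable[OF
              smooth_on_D[OF smooth_transition[OF \<phi> \<psi>]] x]]])
    have "tvec_of TA (induced_chart A \<phi>) u (b', c') \<Psi>
        = (jac \<phi> \<psi> p b', D (\<lambda>x. D (transition \<phi> \<psi>) x (v \<phi>)) (chart_map \<phi> p) b' + jac \<phi> \<psi> p c')" for b' c'
      unfolding T.tvec_of_apply[OF True] unfolding uv \<Psi> by (rule jac_induced[OF p])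
    then show ?thesis using True by (simp add: mirror_def 0 1)
  qed (simp add: mirror_def tvec_of_def)
qed

lemma local_form_comp_mirror:
  assumes \<phi>: "\<phi> \<in> A" and x: "x \<in> chart_image \<phi>"
  shows "local_form TA (comp_mirror A \<alpha>) (induced_chart A \<phi>) (x, a) (b, c)
    = local_form TA \<alpha> (induced_chart A \<phi>) (x, a) (0, b)"
proof -
  interpret T: smooth_atlas TA by (rule tangent_atlas_smooth)
  let ?u = "chart_inv (induced_chart A \<phi>) (x, a)"
  have "?u \<in> chart_dom (induced_chart A \<phi>)"
    using x by (intro chart_inv_in_dom) (simp add: induced_image[OF \<phi>])
  then have u: "induced_chart A \<phi> \<in> charts_at TA ?u" and "?u \<in> points TA"
    using induced_in[OF \<phi>] by (auto simp: in_charts_at points_def)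
  then show ?thesis
    by (simp add: local_form_def comp_mirror_def T.tvec_of_in_tangent_space[OF u] mirror_tvec_of[OF \<phi> u])
qed

section \<open>Fibrewise affine functions\<close>

lemma f_form_in_chart:
  assumes \<phi>: "\<phi> \<in> A" and x: "x \<in> chart_image \<phi>"
  shows "(f_form \<nu> c \<circ> chart_inv (induced_chart A \<phi>)) (x, a)
    = local_form A \<nu> \<phi> x a + (c \<circ> chart_inv \<phi>) x"
  by (simp add: induced_inv[OF \<phi> x] f_form_def local_form_def)

context
  fixes \<nu> c
  assumes \<nu>: "\<nu> \<in> one_forms A" and c: "c \<in> smooth_functions A"
begin

lemma f_form_smooth: "f_form \<nu> c \<in> smooth_functions TA"
  unfolding smooth_functions_def
proof (intro CollectI ballI)
  fix \<Phi> assume "\<Phi> \<in> TA"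
  then obtain \<phi> where \<phi>: "\<phi> \<in> A" and \<Phi>: "\<Phi> = induced_chart A \<phi>" by (auto simp: tangent_atlas_def)
  have op: "open (chart_image \<phi> \<times> (UNIV :: 'e set))"
    by (intro open_Times open_chart_image[OF \<phi>] open_UNIV)
  have "smooth_on (\<lambda>y. (\<lambda>(x, a). local_form A \<nu> \<phi> x a) y + (c \<circ> chart_inv \<phi>) (fst y)) (chart_image \<phi> \<times> UNIV)"
    using c \<phi> by (intro smooth_on_add smooth_on_fst linear_family_smooth_on linear_local_form[OF \<nu> \<phi>]
        smooth_local_form[OF \<nu> \<phi>] op open_chart_image[OF \<phi>]) (auto simp: smooth_functions_def comp_def)
  then show "smooth_on (f_form \<nu> c \<circ> chart_inv \<Phi>) (chart_image \<Phi>)"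
    unfolding \<Phi> induced_image[OF \<phi>]
    by (subst smooth_on_cong[OF op]) (auto simp del: o_apply simp: f_form_in_chart[OF \<phi>] mem_Times_iff)
qed

lemma local_form_differential_f_form:
  assumes \<phi>: "\<phi> \<in> A" and x: "x \<in> chart_image \<phi>"
  shows "local_form TA (differential TA (f_form \<nu> c)) (induced_chart A \<phi>) (x, a) (b, e)
    = D (\<lambda>z. local_form A \<nu> \<phi> z a) x b + local_form A \<nu> \<phi> x e + D (c \<circ> chart_inv \<phi>) x b"
proof -
  interpret T: smooth_atlas TA by (rule tangent_atlas_smooth)
  let ?G = "local_form A \<nu> \<phi>"
  have y: "(x, a) \<in> chart_image \<phi> \<times> UNIV" using x by simp
  have op: "open (chart_image \<phi> \<times> (UNIV :: 'e set))"
    by (intro open_Times open_chart_image[OF \<phi>] open_UNIV)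
  have 1: "((\<lambda>(x, a). ?G x a) has_derivative (\<lambda>(b, e). D (\<lambda>z. ?G z a) x b + ?G x e)) (at (x, a))"
    by (rule linear_family_has_derivative[OF open_chart_image[OF \<phi>] x linear_local_form[OF \<nu> \<phi>]])
      (assumption, rule differentiable_local_form[OF \<nu> \<phi> x])
  have 2: "((\<lambda>y. (c \<circ> chart_inv \<phi>) (fst y)) has_derivative (\<lambda>y. D (c \<circ> chart_inv \<phi>) x (fst y))) (at (x, a))"
    using has_derivative_compose[OF bounded_linear_imp_has_derivative[OF bounded_linear_fst],
        of "c \<circ> chart_inv \<phi>" _ "(x, a)"] D_has_derivative[OF smooth_function_differentiable[OF c \<phi> x]]
    unfolding fst_conv by blast
  have "D (f_form \<nu> c \<circ> chart_inv (induced_chart A \<phi>)) (x, a)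
      = D (\<lambda>y. (\<lambda>(x, a). ?G x a) y + (c \<circ> chart_inv \<phi>) (fst y)) (x, a)"
    by (rule D_cong[OF op y]) (auto simp del: o_apply simp: f_form_in_chart[OF \<phi>] mem_Times_iff)
  also have "\<dots> = (\<lambda>y. (\<lambda>(b, e). D (\<lambda>z. ?G z a) x b + ?G x e) y + D (c \<circ> chart_inv \<phi>) x (fst y))"
    by (rule D_eqI[OF has_derivative_add[OF 1 2]])
  finally show ?thesis
    using T.local_form_differential[OF f_form_smooth induced_in[OF \<phi>], of "(x, a)" "(b, e)"] x
    by (simp add: induced_image[OF \<phi>])
qed

lemma comp_mirror_differential_f_form:
  "comp_mirror A (differential TA (f_form \<nu> c)) = lift \<nu>"
proof (rule form_eqI_TA)
  fix \<phi> x a b e assume \<phi>: "\<phi> \<in> A" and x: "x \<in> chart_image \<phi>"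
  have "D (\<lambda>z. local_form A \<nu> \<phi> z a) x 0 = 0" "D (c \<circ> chart_inv \<phi>) x 0 = 0"
    using linear_0[OF linear_D[OF differentiable_local_form[OF \<nu> \<phi> x]]]
      linear_0[OF linear_D[OF smooth_function_differentiable[OF c \<phi> x]]] by blast+
  then show "local_form TA (comp_mirror A (differential TA (f_form \<nu> c))) (induced_chart A \<phi>) (x, a) (b, e)
      = local_form TA (lift \<nu>) (induced_chart A \<phi>) (x, a) (b, e)"
    unfolding local_form_comp_mirror[OF \<phi> x] local_form_lift[OF \<phi> x] local_form_differential_f_form[OF \<phi> x]
    by simp
qed (auto simp: comp_mirror_def pullback_def)

text \<open>
  The function \<open>f_form \<nu> c\<close> restricts to \<open>c\<close> on the zero section.
\<close>

lemma zero_section_differential_f_form: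
  "at_zero_section (differential TA (f_form \<nu> c)) = differential A c"
proof (rule form_eqI)
  fix \<phi> x b assume \<phi>: "\<phi> \<in> A" and x: "x \<in> chart_image \<phi>"
  have "D (\<lambda>z. local_form A \<nu> \<phi> z 0) x = D (\<lambda>z. 0) x"
    by (rule D_cong[OF open_chart_image[OF \<phi>] x]) (rule linear_0[OF linear_local_form[OF \<nu> \<phi>]])
  then show "local_form A (at_zero_section (differential TA (f_form \<nu> c))) \<phi> x b
      = local_form A (differential A c) \<phi> x b"
    unfolding local_form_zero_section[OF \<phi> x] local_form_differential_f_form[OF \<phi> x]
      local_form_differential[OF c \<phi> x]
    by (simp add: linear_0[OF linear_local_form[OF \<nu> \<phi> x]])
qed (auto simp: pullback_def differential_def)

end

section \<open>Closed forms of type alpha_mu\<close>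

lemma Z_forms_iff:
  "\<alpha> \<in> Z_forms A \<longleftrightarrow> \<alpha> \<in> smooth_atlas.closed_forms TA \<and> (\<exists>\<mu>\<in>one_forms A. comp_mirror A \<alpha> = lift \<mu>)"
  unfolding Z_forms_def smooth_atlas.closed_forms_def[OF tangent_atlas_smooth] by blast

lemma comp_mirror_add: "comp_mirror A (\<alpha> + \<beta>) = comp_mirror A \<alpha> + comp_mirror A \<beta>"
  by (auto simp: comp_mirror_def fun_eq_iff)

lemma comp_mirror_scaleR: "comp_mirror A (r *\<^sub>R \<alpha>) = r *\<^sub>R comp_mirror A \<alpha>"
  by (auto simp: comp_mirror_def fun_eq_iff scaleR_fun_def)

lemma subspace_Z_forms: "subspace (Z_forms A)"
proof -
  note sub = smooth_atlas.subspace_closed_forms[OF tangent_atlas_smooth]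
  note lift_add = linear_in_charts.pullback_add[OF projection_in_charts]
  note lift_scaleR = linear_in_charts.pullback_scaleR[OF projection_in_charts]
  show ?thesis
  proof (rule subspaceI)
    have "comp_mirror A 0 = lift 0" by (auto simp: comp_mirror_def pullback_def fun_eq_iff)
    then show "0 \<in> Z_forms A"
      unfolding Z_forms_iff using subspace_0[OF sub] subspace_0[OF subspace_one_forms] by blast
  next
    fix \<alpha> \<beta> assume "\<alpha> \<in> Z_forms A" "\<beta> \<in> Z_forms A"
    then obtain \<mu> \<nu> where \<alpha>: "\<alpha> \<in> smooth_atlas.closed_forms TA" "\<mu> \<in> one_forms A" "comp_mirror A \<alpha> = lift \<mu>"
      and \<beta>: "\<beta> \<in> smooth_atlas.closed_forms TA" "\<nu> \<in> one_forms A" "comp_mirror A \<beta> = lift \<nu>"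
      unfolding Z_forms_iff by blast
    have "comp_mirror A (\<alpha> + \<beta>) = lift (\<mu> + \<nu>)"
      unfolding comp_mirror_add lift_add \<alpha>(3) \<beta>(3) ..
    then show "\<alpha> + \<beta> \<in> Z_forms A"
      unfolding Z_forms_iff
      using subspace_add[OF sub \<alpha>(1) \<beta>(1)] subspace_add[OF subspace_one_forms \<alpha>(2) \<beta>(2)] by blast
  next
    fix r \<alpha> assume "\<alpha> \<in> Z_forms A"
    then obtain \<mu> where \<alpha>: "\<alpha> \<in> smooth_atlas.closed_forms TA" "\<mu> \<in> one_forms A" "comp_mirror A \<alpha> = lift \<mu>"
      unfolding Z_forms_iff by blast
    have "comp_mirror A (r *\<^sub>R \<alpha>) = lift (r *\<^sub>R \<mu>)"
      unfolding comp_mirror_scaleR lift_scaleR \<alpha>(3) ..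
    then show "r *\<^sub>R \<alpha> \<in> Z_forms A"
      unfolding Z_forms_iff
      using subspace_scale[OF sub \<alpha>(1)] subspace_scale[OF subspace_one_forms \<alpha>(2)] by blast
  qed
qed

lemma E_subset_Z: "E_forms A \<subseteq> Z_forms A"
proof
  fix \<alpha> assume "\<alpha> \<in> E_forms A"
  then obtain \<nu> c where \<nu>: "\<nu> \<in> one_forms A" and c: "c \<in> smooth_functions A"
    and \<alpha>: "\<alpha> = differential TA (f_form \<nu> c)"
    unfolding E_forms_def by blast
  show "\<alpha> \<in> Z_forms A"
    unfolding Z_forms_iff \<alpha>
    using smooth_atlas.differential_closed[OF tangent_atlas_smooth f_form_smooth[OF \<nu> c]]
      comp_mirror_differential_f_form[OF \<nu> c] \<nu> by blast
qed

text \<open>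
  A pullback from \<open>M\<close> vanishes on vertical vectors, so it is of type $\alpha_\mu$ with $\mu = 0$.
\<close>

lemma lift_closed_in_Z:
  assumes \<beta>: "\<beta> \<in> closed_forms"
  shows "lift \<beta> \<in> Z_forms A"
proof -
  have "comp_mirror A (lift \<beta>) = lift 0"
  proof (rule form_eqI_TA)
    fix \<phi> x a b e assume \<phi>: "\<phi> \<in> A" and x: "x \<in> chart_image \<phi>"
    show "local_form TA (comp_mirror A (lift \<beta>)) (induced_chart A \<phi>) (x, a) (b, e)
        = local_form TA (lift 0) (induced_chart A \<phi>) (x, a) (b, e)"
      unfolding local_form_comp_mirror[OF \<phi> x] local_form_lift[OF \<phi> x] local_form_0
      by (rule linear_0[OF linear_local_form[OF closed_forms_one_forms[OF \<beta>] \<phi> x]])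
  qed (auto simp: comp_mirror_def pullback_def)
  then show ?thesis
    unfolding Z_forms_iff
    using linear_in_charts.pullback_closed[OF projection_in_charts \<beta>] subspace_0[OF subspace_one_forms] by blast
qed

lemma zero_section_lift:
  assumes \<beta>: "\<beta> \<in> one_forms A"
  shows "at_zero_section (lift \<beta>) = \<beta>"
proof (rule form_eqI)
  fix \<phi> x b assume \<phi>: "\<phi> \<in> A" and x: "x \<in> chart_image \<phi>"
  show "local_form A (at_zero_section (lift \<beta>)) \<phi> x b = local_form A \<beta> \<phi> x b"
    unfolding local_form_zero_section[OF \<phi> x] local_form_lift[OF \<phi> x] ..
qed (use one_forms_outside[OF \<beta>] in \<open>auto simp: pullback_def\<close>)

text \<open>
  Every $\alpha = h_i\,dx^i + a_i\,dv^i$ in \<open>Z_forms A\<close> is determined by $\mu = a_i\,dx^i$ and by its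
  restriction to the zero section. Since $a_i$ depends on \<open>x\<close> only, the $dx^i \wedge dv^j$
  components of $d\alpha = 0$ read $\partial h_i / \partial v^j = \partial a_j / \partial x^i$. Hence
  $h_i$ has constant derivative along the line from $(x, 0)$ to $(x, a)$, and
  $h_i(x, a) = h_i(x, 0) + a^j\,\partial a_j / \partial x^i$.
\<close>

lemma local_form_Z:
  assumes \<alpha>: "\<alpha> \<in> smooth_atlas.closed_forms TA" and \<mu>: "\<mu> \<in> one_forms A"
    and mir: "comp_mirror A \<alpha> = lift \<mu>" and \<phi>: "\<phi> \<in> A" and x: "x \<in> chart_image \<phi>"
  shows "local_form TA \<alpha> (induced_chart A \<phi>) (x, a) (b, e)
    = D (\<lambda>z. local_form A \<mu> \<phi> z a) x b + local_form A \<mu> \<phi> x e + local_form A (at_zero_section \<alpha>) \<phi> x b"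
proof -
  interpret T: smooth_atlas TA by (rule tangent_atlas_smooth)
  let ?\<Phi> = "induced_chart A \<phi>" and ?G = "local_form A \<mu> \<phi>"
  let ?H = "local_form TA \<alpha> ?\<Phi>"
  note \<Phi> = induced_in[OF \<phi>]
  note \<alpha>1 = T.closed_forms_one_forms[OF \<alpha>]
  have img: "y \<in> chart_image ?\<Phi> \<longleftrightarrow> fst y \<in> chart_image \<phi>" for y
    by (simp add: induced_image[OF \<phi>] mem_Times_iff)
  have vert: "?H y (0, e) = ?G (fst y) e" if "y \<in> chart_image ?\<Phi>" for y e
    using local_form_comp_mirror[OF \<phi>, of "fst y" \<alpha> "snd y" e 0] that
    unfolding mir local_form_lift[OF \<phi> that[unfolded img]] by (simp add: img)
  have deriv: "D (\<lambda>y. ?H y (b, 0)) (x, a') (0, a) = D (\<lambda>z. ?G z a) x b" for a'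
  proof -
    have y: "(x, a') \<in> chart_image ?\<Phi>" using x by (simp add: img)
    (* the dx dv component of closedness; the dv coefficient of alpha depends on x only *)
    have "D (\<lambda>y. ?H y (b, 0)) (x, a') (0, a) = D (\<lambda>y. ?H y (0, a)) (x, a') (b, 0)"
      by (rule T.closed_formsD[OF \<alpha> \<Phi> y])
    also have "D (\<lambda>y. ?H y (0, a)) (x, a') = D (\<lambda>y. ?G (fst y) a) (x, a')"
      by (rule D_cong[OF T.open_chart_image[OF \<Phi>] y]) (rule vert)
    also have "\<dots> = (\<lambda>v. D (\<lambda>z. ?G z a) (fst (x, a')) (fst v))"
      using differentiable_local_form[OF \<mu> \<phi> x] by (intro D_comp_bounded_linear bounded_linear_fst) simp
    finally show ?thesis by simp
  qed
  (* the coefficient of dx in direction b, along the line in the fibre from 0 to a *)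
  let ?h = "\<lambda>s. ?H ((x, 0) + s *\<^sub>R (0, a)) (b, 0)"
  have h: "(?h has_real_derivative D (\<lambda>z. ?G z a) x b) (at s)" for s
  proof -
    have "(\<lambda>y. ?H y (b, 0)) differentiable at ((x, 0) + s *\<^sub>R (0, a))"
      by (rule T.differentiable_local_form[OF \<alpha>1 \<Phi>]) (simp add: img x)
    from line_has_derivative[OF this] show ?thesis by (simp add: deriv)
  qed
  have "?h 1 - ?h 0 = (1 - 0) * D (\<lambda>z. ?G z a) x b"
    using MVT2[OF zero_less_one h] by auto
  then have "?H (x, a) (b, 0) = D (\<lambda>z. ?G z a) x b + ?H (x, 0) (b, 0)" by simp
  moreover have xa: "(x, a) \<in> chart_image ?\<Phi>" using x by (simp add: img)
  have "?H (x, a) (b, e) = ?H (x, a) (b, 0) + ?H (x, a) (0, e)"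
    using linear_add[OF T.linear_local_form[OF \<alpha>1 \<Phi> xa], of "(b, 0)" "(0, e)"] by simp
  ultimately show ?thesis
    by (simp add: vert[OF xa] local_form_zero_section[OF \<phi> x])
qed

text \<open>
  Comparing the expression for a form in \<open>Z_forms A\<close> with the one for the differential of
  \<open>f_form \<mu> c\<close>, the two agree as soon as the restriction to the zero section is \<open>dc\<close>.
\<close>

lemma E_forms_eq: "E_forms A = {\<alpha> \<in> Z_forms A. at_zero_section \<alpha> \<in> differential A ` smooth_functions A}"
proof (intro set_eqI iffI CollectI conjI; (elim CollectE conjE)?)
  fix \<alpha> assume \<alpha>: "\<alpha> \<in> E_forms A"
  then show "\<alpha> \<in> Z_forms A" by (rule subsetD[OF E_subset_Z])
  from \<alpha> obtain \<nu> c where \<nu>: "\<nu> \<in> one_forms A" and c: "c \<in> smooth_functions A"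
    and \<alpha>: "\<alpha> = differential TA (f_form \<nu> c)"
    unfolding E_forms_def by blast
  show "at_zero_section \<alpha> \<in> differential A ` smooth_functions A"
    unfolding \<alpha> zero_section_differential_f_form[OF \<nu> c] using c by (rule imageI)
next
  fix \<alpha> assume "\<alpha> \<in> Z_forms A" "at_zero_section \<alpha> \<in> differential A ` smooth_functions A"
  then obtain \<mu> c where \<alpha>: "\<alpha> \<in> smooth_atlas.closed_forms TA" and \<mu>: "\<mu> \<in> one_forms A"
    and mir: "comp_mirror A \<alpha> = lift \<mu>" and c: "c \<in> smooth_functions A" and r: "at_zero_section \<alpha> = differential A c"
    unfolding Z_forms_iff by blast
  interpret T: smooth_atlas TA by (rule tangent_atlas_smooth)
  have "\<alpha> = differential TA (f_form \<mu> c)"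
  proof (rule form_eqI_TA)
    fix \<phi> x a b e assume \<phi>: "\<phi> \<in> A" and x: "x \<in> chart_image \<phi>"
    show "local_form TA \<alpha> (induced_chart A \<phi>) (x, a) (b, e)
        = local_form TA (differential TA (f_form \<mu> c)) (induced_chart A \<phi>) (x, a) (b, e)"
      unfolding local_form_Z[OF \<alpha> \<mu> mir \<phi> x] local_form_differential_f_form[OF \<mu> c \<phi> x] r
        local_form_differential[OF c \<phi> x] ..
  qed (use T.one_forms_outside[OF T.closed_forms_one_forms[OF \<alpha>]] in \<open>auto simp: differential_def\<close>)
  then show "\<alpha> \<in> E_forms A" unfolding E_forms_def using \<mu> c by blast
qed

text \<open>
  The pullback along the projection is a right inverse, because the zero section is a section.
\<close>

lemma zero_section_Z_forms: "at_zero_section ` Z_forms A = closed_forms"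
proof (intro set_eqI iffI)
  fix \<beta> assume "\<beta> \<in> at_zero_section ` Z_forms A"
  then obtain \<alpha> where "\<alpha> \<in> Z_forms A" and \<beta>: "\<beta> = at_zero_section \<alpha>" by blast
  then have \<alpha>: "\<alpha> \<in> smooth_atlas.closed_forms TA" unfolding Z_forms_iff by blast
  show "\<beta> \<in> closed_forms"
    unfolding \<beta> by (rule linear_in_charts.pullback_closed[OF zero_section_in_charts \<alpha>])
next
  fix \<beta> assume \<beta>: "\<beta> \<in> closed_forms"
  show "\<beta> \<in> at_zero_section ` Z_forms A"
    using imageI[OF lift_closed_in_Z[OF \<beta>], of at_zero_section]
    unfolding zero_section_lift[OF closed_forms_one_forms[OF \<beta>]] .
qed

end

text \<open>
  The topology of \<open>X\<close> enters through the charts only: as these are homeomorphisms onto open sets,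
  they map the overlaps of their domains to open sets.
\<close>

lemma smooth_manifold_smooth_atlas:
  assumes M: "smooth_manifold m X A"
  shows "smooth_atlas A"
proof
  fix \<phi> assume \<phi>: "\<phi> \<in> A"
  have hom: "homeomorphic_map (subtopology X (chart_dom \<phi>)) (top_of_set (chart_image \<phi>)) (chart_map \<phi>)"
    and op: "openin X (chart_dom \<phi>)" "open (chart_image \<phi>)"
    using M \<phi> unfolding smooth_manifold_def by blast+
  have top: "topspace (subtopology X (chart_dom \<phi>)) = chart_dom \<phi>"
    using openin_subset[OF op(1)] by (auto simp: topspace_subtopology)
  show "inj_on (chart_map \<phi>) (chart_dom \<phi>)"
    using homeomorphic_imp_injective_map[OF hom] unfolding top .
  fix \<psi> assume \<psi>: "\<psi> \<in> A"
  have "openin X (chart_dom \<psi>)" using M \<psi> unfolding smooth_manifold_def by blast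
  then have "openin (subtopology X (chart_dom \<phi>)) (chart_dom \<phi> \<inter> chart_dom \<psi>)"
    by (rule openin_subtopology_Int2)
  then have "openin (top_of_set (chart_image \<phi>)) (overlap \<phi> \<psi>)"
    using homeomorphic_map_openness[OF hom, of "chart_dom \<phi> \<inter> chart_dom \<psi>"] 
      openin_subset[OF op(1)] by (simp add: top le_infI1)
  then show "open (overlap \<phi> \<psi>)" using openin_open_trans op(2) by blast
  show "smooth_on (transition \<phi> \<psi>) (overlap \<phi> \<psi>)"
    using M \<phi> \<psi> unfolding smooth_manifold_def by blast
qed

theorem theorem2:
  fixes m :: nat and X :: "'a topology" and A :: "('a, 'e::finite_dim_inner) chart set"
  assumes "smooth_manifold m X A"
  shows "subspace (Z_forms A) \<and> subspace (E_forms A) \<and> E_forms A \<subseteq> Z_forms A \<and>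
    vs_isomorphic (quotient_vs (Z_forms A) (E_forms A)) (deRham_H1 A)"
proof -
  interpret smooth_atlas A by (rule smooth_manifold_smooth_atlas[OF assms])
  have lin: "linear at_zero_section"
    by (intro linearI linear_in_charts.pullback_add[OF zero_section_in_charts]
        linear_in_charts.pullback_scaleR[OF zero_section_in_charts])
  have sub: "differential A ` smooth_functions A \<subseteq> closed_forms"
    using differential_closed by (rule image_subsetI)
  note iso = quotient_vs_isomorphic[OF lin subspace_Z_forms subspace_exact zero_section_Z_forms sub E_forms_eq]
  have "deRham_H1 A = quotient_vs closed_forms (differential A ` smooth_functions A)"
    unfolding deRham_H1_def closed_forms_def ..
  then show ?thesis using subspace_Z_forms iso E_subset_Z by simp
qed

end
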